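(* For every real $p\in(1,2]$ there exist a constant $c_p\in(0,2)$ and a sequence $\eta_n\to 0$ (as $n\to\infty$), both depending only on $p$, such that for every $n\in\mathbb{N}$ and every integer vector $\mathbf{k}=(k_1,\dots,k_{m+1})$ with $0=k_1<k_2<\cdots<k_{m+1}=n$, $$\Delta_{p,\mathbf{k}}(n)\ \ge\ (1+\eta_n)\,\frac{\log(2/c_p)\cdot n}{2^n}.$$
   Context: Throughout, $\log$ is the natural logarithm. Let $n\in\mathbb{N}$, $p\ge 1$ real, and $\mathbf{k}=(k_1,\dots,k_{m+1})$ integers with $0=k_1<k_2<\cdots<k_{m+1}=n$. For $\mathbf{x}=(x_1,\dots,x_n)\in\mathbb{R}^n$ put $\mathbf{x}_j=(x_{k_j+1},x_{k_j+2},\dots,x_{k_{j+1}})$ for $j=1,\dots,m$, and define $\|\mathbf{x}\|_{p,\mathbf{k},n}=\big(\sum_{j=1}^m\|\mathbf{x}_j\|_2^p\big)^{1/p}$, where $\|\cdot\|_2$ is the Euclidean norm; this is a norm on $\mathbb{R}^n$. Let $d(\mathbf{x},\mathbf{y})=\|\mathbf{y}-\mathbf{x}\|_{p,\mathbf{k},n}$. The superball of radius $r$ and center $\mathbf{x}$ is $B^n_{p,\mathbf{k}}(\mathbf{x},r)=\{\mathbf{y}\in\mathbb{R}^n: d(\mathbf{x},\mathbf{y})\le r\}$, and $B^n_{p,\mathbf{k}}(r)=B^n_{p,\mathbf{k}}(\mathbf{0},r)$. Let $r_{p,\mathbf{k},n}$ be the radius for which $\mathrm{vol}(B^n_{p,\mathbf{k}}(r_{p,\mathbf{k},n}))=1$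 (so $\mathrm{vol}(B^n_{p,\mathbf{k}}(r))=(r/r_{p,\mathbf{k},n})^n$). The maximum translative packing density is $$\Delta_{p,\mathbf{k}}(n)=\limsup_{R\to\infty}\sup_{\mathcal{P}}\frac{\mathrm{vol}\big(B^n_{p,\mathbf{k}}(R)\cap\bigcup_{\mathbf{x}\in\mathcal{P}}B^n_{p,\mathbf{k}}(\mathbf{x},r_{p,\mathbf{k},n})\big)}{\mathrm{vol}(B^n_{p,\mathbf{k}}(R))},$$ the supremum being over all $\mathcal{P}\subseteq\mathbb{R}^n$ such that the superballs $B^n_{p,\mathbf{k}}(\mathbf{x},r_{p,\mathbf{k},n})$, $\mathbf{x}\in\mathcal{P}$, have pairwise disjoint interiors. *)

theory Defs
  imports "HOL-Analysis.Analysis"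
begin

text \<open>Vectors of R^n are represented as extensional functions on the index set {..<n}
  (coordinate x_{i+1} of the paper is x i here). Lebesgue measure on R^n is the product
  of n copies of lborel.\<close>

definition Rn :: "nat \<Rightarrow> (nat \<Rightarrow> real) set" where
  "Rn n = PiE {..<n} (\<lambda>_. UNIV)"

definition lebn :: "nat \<Rightarrow> (nat \<Rightarrow> real) measure" where
  "lebn n = PiM {..<n} (\<lambda>_. lborel)"

text \<open>The block vector k = (k_1,...,k_{m+1}) is the list ks of length m+1
  with 0 = k_1 < ... < k_{m+1} = n; we require m >= 1 so that the blocks form a norm.\<close>

definition valid_k :: "nat \<Rightarrow> nat list \<Rightarrow> bool" where
  "valid_k n ks \<longleftrightarrow> length ks \<ge> 2 \<and> sorted_wrt (<) ks \<and> hd ks = 0 \<and> last ks = n"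

definition sk_norm :: "real \<Rightarrow> nat list \<Rightarrow> (nat \<Rightarrow> real) \<Rightarrow> real" where
  "sk_norm p ks x =
     (\<Sum>j<length ks - 1. (sqrt (\<Sum>i\<in>{ks!j..<ks!(j+1)}. (x i)^2)) powr p) powr (1/p)"

definition superball :: "nat \<Rightarrow> real \<Rightarrow> nat list \<Rightarrow> (nat \<Rightarrow> real) \<Rightarrow> real \<Rightarrow> (nat \<Rightarrow> real) set" where
  "superball n p ks x r = {y \<in> Rn n. sk_norm p ks (\<lambda>i. y i - x i) \<le> r}"

definition unit_radius :: "nat \<Rightarrow> real \<Rightarrow> nat list \<Rightarrow> real" where
  "unit_radius n p ks =
     (THE r. 0 < r \<and> emeasure (lebn n) (superball n p ks (\<lambda>_. 0) r) = 1)"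

definition is_packing :: "nat \<Rightarrow> real \<Rightarrow> nat list \<Rightarrow> (nat \<Rightarrow> real) set \<Rightarrow> bool" where
  "is_packing n p ks P \<longleftrightarrow> P \<subseteq> Rn n \<and>
     (\<forall>x\<in>P. \<forall>y\<in>P. x \<noteq> y \<longrightarrow>
        (top_of_set (Rn n)) interior_of (superball n p ks x (unit_radius n p ks)) \<inter>
        (top_of_set (Rn n)) interior_of (superball n p ks y (unit_radius n p ks)) = {})"

definition packing_density :: "real \<Rightarrow> nat list \<Rightarrow> nat \<Rightarrow> ereal" where
  "packing_density p ks n =
     Limsup at_top (\<lambda>R::real. SUP P\<in>{P. is_packing n p ks P}.
        ereal (measure (lebn n) (superball n p ks (\<lambda>_. 0) R \<inter>
                 (\<Union>x\<in>P. superball n p ks x (unit_radius n p ks)))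
               / measure (lebn n) (superball n p ks (\<lambda>_. 0) R)))"

end

(* The norm is uniformly convex with a modulus that depends on p only. Hence, with r the radius of
   the superball of volume 1, two superballs of radius 2r whose centers are at distance at least r
   meet in a set of volume at most (2 theta)^n for some theta < 1 depending on p only. Join two points
   of a large superball of volume V by an edge if their distance is at most 2r: every neighbourhood
   has volume at most 2^n, and common neighbourhoods are exponentially smaller. This room allows a
   greedy choice of about V 4^s / 2^n points, with s proportional to n, that span a triangle-free
   graph of average degree at most 4^s / 2. By the theorem of Ajtai, Komlos and Szemeredi (in Alon's
   form) such a graph has an independent set of order V s / 2^n, which is the set of centers of a
   packing of density of order n / 2^n. For the theorem it suffices to beat eps n / 2^n for all large
   n: put c = 2 exp (- eps), and let eta be 0 for large n and -1 otherwise. *)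

theory Submission
  imports Defs
begin

section \<open>Uniform convexity of the norm\<close>

text \<open>Two costs are balanced. With N about V 4^s / 2^n points and at most 4^s / 4 earlier
  neighbours each, there are at most N 4^s / 4 edges; the common neighbourhoods of their ends have
  volume at most (2 theta)^n each and may fill only a part of V. This is the condition 16^s theta^n
  \<le> 1, which allows s to be proportional to n. The obstacle is a pair of points closer than r,
  whose neighbourhoods may overlap almost entirely. Such pairs are forbidden from the start: balls
  of radius r have volume 1, and N is at most V / 16 as soon as 4^s \<le> 2^n. Counting excluded
  volume takes the place of a random choice with deletions. Uniformity in the block vector comes
  from using only the triangle inequality and the parallelogram law inside a block, and an estimate
  for powers of real numbers across the blocks.\<close>

lemma powr_convex_nonneg:
  fixes p x y u v :: real
  assumes "1 \<le> p" "0 \<le> x" "0 \<le> y" "0 \<le> u" "0 \<le> v" "u + v = 1"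
  shows "(u * x + v * y) powr p \<le> u * x powr p + v * y powr p"
proof -
  \<comment> \<open>This serves an endpoint 0, where the claim reduces to
    \<open>u powr p \<le> u\<close>; \<open>powr_convex\<close> covers the open half-line.\<close>
  have small: "w powr p \<le> w" if "0 \<le> w" "w \<le> 1" for w :: real
    using powr_mono'[of 1 p w] assms(1) that by simp
  consider "x = 0" | "y = 0" | "0 < x" "0 < y" using assms by linarith
  then show ?thesis
  proof cases
    case 1
    have "v powr p * y powr p \<le> v * y powr p"
      using small[of v] assms by (intro mult_right_mono) auto
    then show ?thesis using 1 assms by (simp add: powr_mult)
  next
    case 2
    have "u powr p * x powr p \<le> u * x powr p"
      using small[of u] assms by (intro mult_right_mono) auto
    then show ?thesis using 2 assms by (simp add: powr_mult)
  next
    case 3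
    have v: "v = 1 - u" using assms by simp
    have "convex_on {0<..} (\<lambda>x. x powr p)" by (rule powr_convex[OF assms(1)])
    from convex_onD[OF this, of v x y] 3 assms show ?thesis
      by (simp add: v)
  qed
qed

lemma powr_add_le:
  fixes p x y :: real
  assumes "1 \<le> p" "0 \<le> x" "0 \<le> y"
  shows "(x + y) powr p \<le> 2 powr p * ((x powr p + y powr p) / 2)"
proof -
  have "(x + y) powr p = 2 powr p * (((1/2) * x + (1/2) * y) powr p)"
    by (subst powr_mult[symmetric]) (simp add: distrib_left)
  also have "\<dots> \<le> 2 powr p * ((1/2) * x powr p + (1/2) * y powr p)"
    by (intro mult_left_mono powr_convex_nonneg) (use assms in auto)
  finally show ?thesis by (simp add: field_simps)
qed

text \<open>Written with \<open>s = h * (1 + u)\<close> and \<open>t = h * (1 - u)\<close>, the gap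
  in the power mean inequality grows with the relative difference \<open>u\<close>. The derivative
  is positive because powers with exponent \<open>p - 1\<close> increase.\<close>

lemma powr_symm_sum_strict_mono:
  fixes p u v :: real
  assumes p: "1 < p" and uv: "0 \<le> u" "u < v" "v \<le> 1"
  shows "(1 + u) powr p + (1 - u) powr p < (1 + v) powr p + (1 - v) powr p"
proof (rule DERIV_pos_imp_increasing_open[OF uv(2)])
  fix x assume x: "u < x" "x < v"
  have "((\<lambda>x. (1 + x) powr p + (1 - x) powr p) has_real_derivative
          (p * (1 + x) powr (p - 1) - p * (1 - x) powr (p - 1))) (at x)"
    using x uv by (auto intro!: derivative_eq_intros simp: field_simps)
  moreover have "p * (1 - x) powr (p - 1) < p * (1 + x) powr (p - 1)"
    using x uv p by (intro mult_strict_left_mono powr_less_mono2) auto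
  ultimately show "\<exists>y. ((\<lambda>x. (1 + x) powr p + (1 - x) powr p) has_real_derivative y) (at x) \<and> 0 < y"
    by fastforce
next
  \<comment> \<open>At \<open>v = 1\<close> the second base vanishes, so the derivative is used on
    the open interval only.\<close>
  show "continuous_on {u..v} (\<lambda>x. (1 + x) powr p + (1 - x) powr p)"
    using uv p by (intro continuous_intros continuous_on_powr') auto
qed

text \<open>Here \<open>s\<close>, \<open>t\<close>, \<open>m\<close>, \<open>D\<close> stand for
  the norms of two vectors of an inner product space, of their midpoint and of their difference.
  There are two sources of loss: if \<open>s\<close> and \<open>t\<close> are nearly equal, the
  parallelogram law makes \<open>m\<close> smaller than their mean; otherwise strict convexity
  separates the power of the mean from the mean of the powers.\<close>

lemma powr_mean_gap:
  fixes p \<eta> :: real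
  assumes p: "1 < p" and eta: "0 < \<eta>" "\<eta> \<le> 1"
  shows "\<exists>\<kappa>>0. \<kappa> \<le> 1 \<and> (\<forall>s t D m. 0 \<le> s \<longrightarrow> 0 \<le> t \<longrightarrow> 0 \<le> m \<longrightarrow>
           4 * m\<^sup>2 + D\<^sup>2 = 2 * s\<^sup>2 + 2 * t\<^sup>2 \<longrightarrow> 2 * m \<le> s + t \<longrightarrow> \<eta> * (s + t) \<le> D \<longrightarrow>
           m powr p \<le> (1 - \<kappa>) * ((s powr p + t powr p) / 2))"
proof -
  \<comment> \<open>Let h be the mean and e the half-difference of s and t. For e \<le> \<eta> h / 2
    the parallelogram law gives m^2 \<le> (1 + \<eta>^2 / 4 - \<eta>^2) h^2 \<le> w^2 h^2. Beyond
    this threshold, g / 2 bounds the mean of the p-th powers from below, relative to h^p.\<close>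
  define w where "w = sqrt (1 - \<eta>\<^sup>2 / 2)"
  define u0 where "u0 = \<eta> / 2"
  define g where "g = (1 + u0) powr p + (1 - u0) powr p"
  have e2: "0 < \<eta>\<^sup>2" "\<eta>\<^sup>2 \<le> 1" using eta by (auto simp: power_le_one)
  have w: "0 \<le> w" "w < 1" "w\<^sup>2 = 1 - \<eta>\<^sup>2 / 2"
    using e2 by (auto simp: w_def)
  have g: "2 < g"
    using powr_symm_sum_strict_mono[OF p, of 0 u0] eta by (auto simp: g_def u0_def)
  have wp: "w powr p < 1" using w p
    by (metis less_eq_real_def powr_less_mono2 powr_one_eq_one less_trans zero_less_one)
  define \<kappa> where "\<kappa> = min (1 - w powr p) (1 - 2 / g)"
  have k: "0 < \<kappa>" "\<kappa> \<le> 1" using wp g by (auto simp: \<kappa>_def min_def field_simps)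
  have main: "m powr p \<le> (1 - \<kappa>) * ((s powr p + t powr p) / 2)"
    if a: "0 \<le> t" "t \<le> s" "0 \<le> m" "4 * m\<^sup>2 + D\<^sup>2 = 2 * s\<^sup>2 + 2 * t\<^sup>2" "2 * m \<le> s + t" "\<eta> * (s + t) \<le> D"
    for s t D m
  proof -
    define h e where "h = (s + t) / 2" and "e = (s - t) / 2"
    have st: "s = h + e" "t = h - e" by (auto simp: h_def e_def field_simps)
    have he: "0 \<le> e" "e \<le> h" "0 \<le> h" using a by (auto simp: h_def e_def)
    have mh: "m \<le> h" using a by (simp add: h_def)
    have hp: "h powr p \<le> (s powr p + t powr p) / 2"
      using powr_convex_nonneg[of p s t "1/2" "1/2"] a p by (simp add: h_def field_simps)
    have nn: "0 \<le> (s powr p + t powr p) / 2" by simp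
    show ?thesis
    proof (cases "e \<le> u0 * h")
      case True
      have "(\<eta> * (2 * h))\<^sup>2 \<le> D\<^sup>2"
        using a(6) he eta by (intro power_mono) (auto simp: st)
      moreover have "e\<^sup>2 \<le> (u0 * h)\<^sup>2" using True he by (intro power_mono) auto
      moreover have "m\<^sup>2 = h\<^sup>2 + e\<^sup>2 - D\<^sup>2 / 4" 
        using a(4) unfolding st by (simp add: power2_eq_square algebra_simps)
      ultimately have "m\<^sup>2 \<le> h\<^sup>2 + (u0 * h)\<^sup>2 - (\<eta> * (2 * h))\<^sup>2 / 4" by linarith
      also have "\<dots> = h\<^sup>2 - (3/4) * (\<eta>\<^sup>2 * h\<^sup>2)" 
        by (simp add: u0_def power2_eq_square algebra_simps)
      also have "\<dots> \<le> h\<^sup>2 - (1/2) * (\<eta>\<^sup>2 * h\<^sup>2)" using e2 by simp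
      also have "\<dots> = (w * h)\<^sup>2" by (simp add: power_mult_distrib w algebra_simps)
      finally have "m \<le> w * h" by (rule power2_le_imp_le) (use w he in simp)
      then have "m powr p \<le> (w * h) powr p" using a p by (intro powr_mono2) auto
      also have "\<dots> = w powr p * h powr p" using w he by (simp add: powr_mult)
      also have "\<dots> \<le> w powr p * ((s powr p + t powr p) / 2)" by (intro mult_left_mono hp) simp
      also have "\<dots> \<le> (1 - \<kappa>) * ((s powr p + t powr p) / 2)"
        by (intro mult_right_mono nn) (simp add: \<kappa>_def)
      finally show ?thesis .
    next
      case False
      then have h: "0 < h" using he 
        by (cases "h = 0") auto
      define u where "u = e / h"
      have u: "u0 \<le> u" "u \<le> 1" using False h he by (auto simp: u_def field_simps)
      have u0: "0 \<le> u0" using eta by (simp add: u0_def)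
      have gu: "g \<le> (1 + u) powr p + (1 - u) powr p"
        using powr_symm_sum_strict_mono[OF p u0, of u] u by (cases "u0 = u") (auto simp: g_def)
      have "s = h * (1 + u)" "t = h * (1 - u)" using h by (auto simp: st u_def field_simps)
      then have "s powr p + t powr p = h powr p * ((1 + u) powr p + (1 - u) powr p)"
        by (simp only: powr_mult distrib_left[of "h powr p"])
      also have "\<dots> \<ge> h powr p * g" by (intro mult_left_mono gu) simp
      finally have "h powr p \<le> (2 / g) * ((s powr p + t powr p) / 2)"
        using g by (simp add: field_simps)
      also have "\<dots> \<le> (1 - \<kappa>) * ((s powr p + t powr p) / 2)"
        by (intro mult_right_mono nn) (simp add: \<kappa>_def)
      finally show ?thesis using powr_mono2[of p m h] mh a p by simp
    qed
  qed
  show ?thesis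
  proof (intro exI[of _ \<kappa>] conjI allI impI k)
    fix s t D m :: real
    assume a: "0 \<le> s" "0 \<le> t" "0 \<le> m" "4 * m\<^sup>2 + D\<^sup>2 = 2 * s\<^sup>2 + 2 * t\<^sup>2" "2 * m \<le> s + t" "\<eta> * (s + t) \<le> D"
    show "m powr p \<le> (1 - \<kappa>) * ((s powr p + t powr p) / 2)"
    proof (cases "t \<le> s")
      case True
      then show ?thesis using main[of t s m D] a by blast
    next
      case False
      then have "m powr p \<le> (1 - \<kappa>) * ((t powr p + s powr p) / 2)"
        using main[of s t m D] a by (auto simp: add.commute)
      then show ?thesis by (simp add: add.commute)
    qed
  qed
qed

section \<open>The block norm: homogeneity, triangle inequality, modulus of convexity\<close>

lemma L2_set_parallelogram:
  "4 * (L2_set (\<lambda>i. (a i + b i) / 2) A)\<^sup>2 + (L2_set (\<lambda>i. a i - b i) A)\<^sup>2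
     = 2 * (L2_set a A)\<^sup>2 + 2 * (L2_set b A)\<^sup>2"
proof -
  have "4 * (\<Sum>i\<in>A. ((a i + b i) / 2)\<^sup>2) + (\<Sum>i\<in>A. (a i - b i)\<^sup>2) = 2 * (\<Sum>i\<in>A. (a i)\<^sup>2) + 2 * (\<Sum>i\<in>A. (b i)\<^sup>2)"
    unfolding sum_distrib_left sum.distrib[symmetric]
    by (intro sum.cong refl) (simp add: power2_eq_square algebra_simps field_simps)
  then show ?thesis by (simp add: L2_set_def sum_nonneg)
qed

lemma L2_set_scale: "L2_set (\<lambda>i. c * x i) A = \<bar>c\<bar> * L2_set x A"
  unfolding L2_set_def power_mult_distrib sum_distrib_left[symmetric]
  by (simp add: real_sqrt_mult)

lemma L2_set_diff_le: "L2_set (\<lambda>i. a i - b i) A \<le> L2_set a A + L2_set b A"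
proof -
  have "L2_set (\<lambda>i. - b i) A = L2_set b A" by (simp add: L2_set_def)
  then show ?thesis using L2_set_triangle_ineq[of a "\<lambda>i. - b i" A] by simp
qed

text \<open>The p-th power of the norm is additive over the blocks, so inequalities are proved
  blockwise for it and the root is taken last.\<close>

definition block_pow :: "real \<Rightarrow> nat list \<Rightarrow> (nat \<Rightarrow> real) \<Rightarrow> real" where
  "block_pow p ks x = (\<Sum>j<length ks - 1. L2_set x {ks!j..<ks!(j+1)} powr p)"

lemma sk_norm_block_pow: "sk_norm p ks x = block_pow p ks x powr (1/p)"
  by (simp add: sk_norm_def block_pow_def L2_set_def)

lemma block_pow_nonneg: "0 \<le> block_pow p ks x"
  by (auto simp: block_pow_def intro!: sum_nonneg)

lemma sk_norm_nonneg: "0 \<le> sk_norm p ks x"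
  by (simp add: sk_norm_block_pow)

lemma sk_norm_powr: "p > 0 \<Longrightarrow> sk_norm p ks x powr p = block_pow p ks x"
  using block_pow_nonneg[of p ks x] by (simp add: sk_norm_block_pow powr_powr)

lemma sk_norm_le_iff:
  assumes "p > 0" "0 \<le> r"
  shows "sk_norm p ks x \<le> r \<longleftrightarrow> block_pow p ks x \<le> r powr p"
proof -
  have "sk_norm p ks x \<le> r \<longleftrightarrow> sk_norm p ks x powr p \<le> r powr p"
    using powr_mono2[of p "sk_norm p ks x" r] powr_less_mono2[of p r "sk_norm p ks x"] assms
      sk_norm_nonneg[of p ks x] by force
  then show ?thesis by (simp add: sk_norm_powr assms)
qed

lemma sk_norm_le_1_iff: "p > 0 \<Longrightarrow> sk_norm p ks x \<le> 1 \<longleftrightarrow> block_pow p ks x \<le> 1"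
  using sk_norm_le_iff[of p 1] by simp

lemma block_pow_scale: "block_pow p ks (\<lambda>i. c * x i) = \<bar>c\<bar> powr p * block_pow p ks x"
  by (simp add: block_pow_def L2_set_scale powr_mult sum_distrib_left)

lemma sk_norm_scale: "p > 0 \<Longrightarrow> sk_norm p ks (\<lambda>i. c * x i) = \<bar>c\<bar> * sk_norm p ks x"
  by (simp add: sk_norm_block_pow block_pow_scale powr_mult block_pow_nonneg powr_powr)

lemma sk_norm_minus: "p > 0 \<Longrightarrow> sk_norm p ks (\<lambda>i. - x i) = sk_norm p ks x"
  using sk_norm_scale[of p ks "-1" x] by simp

lemma sk_norm_minus_commute: "p > 0 \<Longrightarrow> sk_norm p ks (\<lambda>i. x i - y i) = sk_norm p ks (\<lambda>i. y i - x i)"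
  using sk_norm_minus[of p ks "\<lambda>i. x i - y i"] by simp

lemma block_pow_convex:
  assumes "1 \<le> p" "0 \<le> u" "0 \<le> v" "u + v = 1"
  shows "block_pow p ks (\<lambda>i. u * x i + v * y i) \<le> u * block_pow p ks x + v * block_pow p ks y"
  unfolding block_pow_def sum_distrib_left sum.distrib[symmetric]
proof (rule sum_mono)
  fix j
  let ?A = "{ks!j..<ks!(j+1)}"
  have "L2_set (\<lambda>i. u * x i + v * y i) ?A \<le> u * L2_set x ?A + v * L2_set y ?A"
    using L2_set_triangle_ineq[of "\<lambda>i. u * x i" "\<lambda>i. v * y i" ?A] assms by (simp add: L2_set_scale)
  then have "L2_set (\<lambda>i. u * x i + v * y i) ?A powr p \<le> (u * L2_set x ?A + v * L2_set y ?A) powr p"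
    using assms by (intro powr_mono2) auto
  also have "\<dots> \<le> u * L2_set x ?A powr p + v * L2_set y ?A powr p"
    using assms by (intro powr_convex_nonneg) auto
  finally show "L2_set (\<lambda>i. u * x i + v * y i) ?A powr p \<le> \<dots>" .
qed

text \<open>Minkowski's inequality, from convexity of the unit ball: the sum of two vectors is a
  multiple of a convex combination of their normalizations.\<close>

lemma sk_norm_triangle:
  assumes p: "1 \<le> p"
  shows "sk_norm p ks (\<lambda>i. x i + y i) \<le> sk_norm p ks x + sk_norm p ks y"
proof (rule field_le_epsilon)
  fix e :: real assume e: "0 < e"
  \<comment> \<open>Adding \<open>e / 2\<close> makes both scaling factors positive, which also
    covers vectors of norm zero.\<close>
  define a b where "a = sk_norm p ks x + e / 2" and "b = sk_norm p ks y + e / 2"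
  have ab: "0 < a" "0 < b" using e sk_norm_nonneg[of p ks] by (auto simp: a_def b_def add_nonneg_pos)
  have one: "block_pow p ks (\<lambda>i. (1/c) * z i) \<le> 1" if "0 < c" "sk_norm p ks z \<le> c" for c z
    using that p sk_norm_scale[of p ks "1/c" z] sk_norm_le_1_iff[of p ks "\<lambda>i. (1/c) * z i"] by simp
  have "(\<lambda>i. (1 / (a + b)) * (x i + y i)) = (\<lambda>i. (a/(a+b)) * ((1/a) * x i) + (b/(a+b)) * ((1/b) * y i))"
    using ab by (auto simp: add_divide_distrib)
  then have "block_pow p ks (\<lambda>i. (1 / (a + b)) * (x i + y i))
      \<le> (a/(a+b)) * block_pow p ks (\<lambda>i. (1/a) * x i) + (b/(a+b)) * block_pow p ks (\<lambda>i. (1/b) * y i)"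
    using block_pow_convex[OF p, of "a/(a+b)" "b/(a+b)" ks "\<lambda>i. (1/a) * x i" "\<lambda>i. (1/b) * y i"] ab
    by (simp add: add_divide_distrib[symmetric])
  also have "\<dots> \<le> (a/(a+b)) * 1 + (b/(a+b)) * 1"
    using ab e by (intro add_mono mult_left_mono one) (auto simp: a_def b_def)
  also have "\<dots> = 1" using ab by (simp add: add_divide_distrib[symmetric])
  finally have "sk_norm p ks (\<lambda>i. (1 / (a + b)) * (x i + y i)) \<le> 1"
    using p sk_norm_le_1_iff by simp
  then have "sk_norm p ks (\<lambda>i. x i + y i) \<le> a + b"
    using p ab sk_norm_scale[of p ks "1/(a+b)" "\<lambda>i. x i + y i"] by (simp add: divide_le_eq)
  then show "sk_norm p ks (\<lambda>i. x i + y i) \<le> sk_norm p ks x + sk_norm p ks y + e"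
    by (simp add: a_def b_def)
qed

text \<open>Blocks with \<open>|a_j - b_j| < (|a_j| + |b_j|) / 8\<close> contribute at most \<open>4 powr - p\<close> to the
  \<open>p\<close>-th power of the distance, so the remaining blocks carry a fixed part of it, and on those the
  gap in the power-mean inequality is available. The modulus does not depend on the blocks.\<close>

lemma block_pow_uniformly_convex:
  assumes p: "1 < p"
  shows "\<exists>\<delta>>0. \<delta> \<le> 1 \<and> (\<forall>ks a b. block_pow p ks a \<le> 1 \<longrightarrow> block_pow p ks b \<le> 1 \<longrightarrow>
           (1/2) powr p \<le> block_pow p ks (\<lambda>i. a i - b i) \<longrightarrow>
           block_pow p ks (\<lambda>i. (a i + b i) / 2) \<le> 1 - \<delta>)"
proof -
  obtain \<kappa> where k: "0 < \<kappa>" "\<kappa> \<le> 1"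
    and gap: "\<And>s t D m. 0 \<le> s \<Longrightarrow> 0 \<le> t \<Longrightarrow> 0 \<le> m \<Longrightarrow>
           4 * m\<^sup>2 + D\<^sup>2 = 2 * s\<^sup>2 + 2 * t\<^sup>2 \<Longrightarrow> 2 * m \<le> s + t \<Longrightarrow> (1/8) * (s + t) \<le> D \<Longrightarrow>
           m powr p \<le> (1 - \<kappa>) * ((s powr p + t powr p) / 2)"
    using powr_mean_gap[OF p, of "1/8"] by auto
  \<comment> \<open>The good blocks carry at least \<open>(1/8) powr p\<close> of the sum of the
    power means, and each of them loses the fraction \<kappa>.\<close>
  define \<delta> where "\<delta> = \<kappa> * (1/8) powr p"
  have "(1/8::real) powr p \<le> 1" using powr_mono2[of p "1/8" 1] p by simp
  then have d: "0 < \<delta>" "\<delta> \<le> 1" using k by (auto simp: \<delta>_def mult_le_one)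
  have "block_pow p ks (\<lambda>i. (a i + b i) / 2) \<le> 1 - \<delta>"
    if a: "block_pow p ks a \<le> 1" and b: "block_pow p ks b \<le> 1"
      and ab: "(1/2) powr p \<le> block_pow p ks (\<lambda>i. a i - b i)" for ks a b
  proof -
    define J where "J = {..<length ks - 1}"
    define A where "A j = {ks!j..<ks!(j+1)}" for j
    define s t D m where "s j = L2_set a (A j)" and "t j = L2_set b (A j)"
      and "D j = L2_set (\<lambda>i. a i - b i) (A j)" and "m j = L2_set (\<lambda>i. (a i + b i) / 2) (A j)" for j
    define c where "c j = (s j powr p + t j powr p) / 2" for j
    define G where "G = {j \<in> J. (1/8) * (s j + t j) \<le> D j}"
    have [simp]: "finite J" by (simp add: J_def)
    have nn: "0 \<le> s j" "0 \<le> t j" "0 \<le> D j" "0 \<le> m j" "0 \<le> c j" for j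
      by (auto simp: s_def t_def D_def m_def c_def)
    have par: "4 * (m j)\<^sup>2 + (D j)\<^sup>2 = 2 * (s j)\<^sup>2 + 2 * (t j)\<^sup>2" for j
      unfolding m_def D_def s_def t_def by (rule L2_set_parallelogram)
    have m2: "2 * m j \<le> s j + t j" for j
    proof -
      have "(\<lambda>i. (a i + b i) / 2) = (\<lambda>i. (1/2) * (a i + b i))" by auto
      then have "2 * m j = L2_set (\<lambda>i. a i + b i) (A j)"
        unfolding m_def by (simp only: L2_set_scale)
      then show ?thesis using L2_set_triangle_ineq by (simp add: s_def t_def)
    qed
    have Dst: "D j \<le> s j + t j" for j
      unfolding D_def s_def t_def by (rule L2_set_diff_le)
    have stp: "(s j + t j) powr p \<le> 2 powr p * c j" for j
      unfolding c_def using p nn by (intro powr_add_le) auto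
    have csum: "sum c J \<le> 1"
      using a b by (simp add: c_def sum_divide_distrib[symmetric] sum.distrib block_pow_def s_def t_def A_def J_def)
    have bad: "D j powr p \<le> (1/4) powr p * c j" if "j \<in> J - G" for j
    proof -
      have "D j powr p \<le> ((1/8) * (s j + t j)) powr p"
        using that nn p by (intro powr_mono2) (auto simp: G_def)
      also have "\<dots> = (1/8) powr p * (s j + t j) powr p"
        by (rule powr_mult)
      also have "\<dots> \<le> (1/8) powr p * (2 powr p * c j)"
        by (intro mult_left_mono stp) simp
      also have "\<dots> = (1/4) powr p * c j" 
        by (simp add: powr_mult[symmetric] mult.assoc[symmetric])
      finally show ?thesis .
    qed
    have good: "D j powr p \<le> 2 powr p * c j" for j
      using powr_mono2[of p "D j" "s j + t j"] stp[of j] Dst[of j] nn p by simp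
    have "(\<Sum>j\<in>J - G. D j powr p) \<le> (1/4) powr p * sum c (J - G)"
      unfolding sum_distrib_left by (intro sum_mono bad)
    also have "\<dots> \<le> (1/4) powr p * 1"
      using csum sum_mono2[of J "J - G" c] nn by (intro mult_left_mono) auto
    finally have B: "(\<Sum>j\<in>J - G. D j powr p) \<le> (1/4) powr p" by simp
    have "(1/2) powr p \<le> (\<Sum>j\<in>J. D j powr p)"
      using ab by (simp add: block_pow_def D_def A_def J_def)
    also have "\<dots> = (\<Sum>j\<in>J - G. D j powr p) + (\<Sum>j\<in>G. D j powr p)"
      by (rule sum.subset_diff) (auto simp: G_def)
    finally have "(1/2) powr p - (1/4) powr p \<le> (\<Sum>j\<in>G. D j powr p)" using B by simp
    also have "\<dots> \<le> 2 powr p * sum c G"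
      unfolding sum_distrib_left by (intro sum_mono good)
    finally have G1: "(1/2) powr p - (1/4) powr p \<le> 2 powr p * sum c G" .
    \<comment> \<open>As p > 1, (1/4)^p is at most half of (1/2)^p, so the good blocks keep at least
      (1/4)^p of the distance; dividing by the factor 2^p of \<open>good\<close> leaves
      (1/8)^p.\<close>
    have "(1/2::real) powr p \<le> 1/2" using powr_mono'[of 1 p "1/2"] p by simp
    then have "(1/2::real) powr p * (1/2) powr p \<le> 1/2 * (1/2) powr p" by (intro mult_right_mono) auto
    moreover have "(1/2::real) powr p * (1/2) powr p = (1/4) powr p" by (simp add: powr_mult[symmetric])
    ultimately have "(1/4) powr p \<le> 2 powr p * sum c G" using G1 by simp
    then have "(1/2) powr p * (1/4) powr p \<le> (1/2) powr p * (2 powr p * sum c G)"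
      by (intro mult_left_mono) auto
    then have cG: "(1/8) powr p \<le> sum c G" by (simp add: powr_mult[symmetric] mult.assoc[symmetric])
    have "(\<Sum>j\<in>J. m j powr p) \<le> (\<Sum>j\<in>J. c j - (if j \<in> G then \<kappa> * c j else 0))"
    proof (rule sum_mono)
      fix j assume "j \<in> J"
      show "m j powr p \<le> c j - (if j \<in> G then \<kappa> * c j else 0)"
      proof (cases "j \<in> G")
        case True
        then have "m j powr p \<le> (1 - \<kappa>) * c j"
          unfolding c_def using nn par m2 by (intro gap[where D="D j"]) (auto simp: G_def)
        then show ?thesis using True by (simp add: algebra_simps)
      next
        case False
        have "(2 * m j) powr p \<le> 2 powr p * c j"
          using powr_mono2[of p "2 * m j" "s j + t j"] stp[of j] m2[of j] nn p by simp
        then show ?thesis using False by (simp add: powr_mult)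
      qed
    qed
    also have "\<dots> = sum c J - (\<Sum>j\<in>G. \<kappa> * c j)"
      by (simp add: sum_subtractf sum.inter_restrict[symmetric] Int_absorb1 G_def
            flip: sum.inter_filter)
    also have "\<dots> = sum c J - \<kappa> * sum c G" by (simp add: sum_distrib_left)
    also have "\<dots> \<le> 1 - \<kappa> * (1/8) powr p"
      using csum cG k by (intro diff_mono mult_left_mono) auto
    finally show ?thesis by (simp add: block_pow_def m_def A_def J_def \<delta>_def)
  qed
  then show ?thesis using d by blast
qed

text \<open>Homogeneity reduces this to the unit ball. The separation \<open>r / 2\<close> fits the
  later use, where \<open>r\<close> is twice the unit radius and the centers are more than one unit
  radius apart.\<close>

lemma sk_norm_uniformly_convex:
  assumes p: "1 < p"
  shows "\<exists>\<theta>>0. \<theta> < 1 \<and> (\<forall>ks a b r. 0 < r \<longrightarrow> sk_norm p ks a \<le> r \<longrightarrow> sk_norm p ks b \<le> r \<longrightarrow>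
           r / 2 \<le> sk_norm p ks (\<lambda>i. a i - b i) \<longrightarrow>
           sk_norm p ks (\<lambda>i. (a i + b i) / 2) \<le> \<theta> * r)"
proof -
  obtain \<delta> where d: "0 < \<delta>" "\<delta> \<le> 1" and uc: "\<And>ks a b. block_pow p ks a \<le> 1 \<Longrightarrow> block_pow p ks b \<le> 1 \<Longrightarrow>
           (1/2) powr p \<le> block_pow p ks (\<lambda>i. a i - b i) \<Longrightarrow>
           block_pow p ks (\<lambda>i. (a i + b i) / 2) \<le> 1 - \<delta>"
    using block_pow_uniformly_convex[OF p] by blast
  \<comment> \<open>Halving \<delta> keeps \<theta> positive even for \<delta> = 1; it will scale
    the radius of a ball.\<close>
  define \<theta> where "\<theta> = (1 - \<delta> / 2) powr (1/p)"
  have th: "0 < \<theta>" "\<theta> < 1" using d p powr_less_mono2[of "1/p" "1 - \<delta>/2" 1] by (auto simp: \<theta>_def)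
  have "sk_norm p ks (\<lambda>i. (a i + b i) / 2) \<le> \<theta> * r"
    if r: "0 < r" and a: "sk_norm p ks a \<le> r" and b: "sk_norm p ks b \<le> r"
      and ab: "r / 2 \<le> sk_norm p ks (\<lambda>i. a i - b i)" for ks a b r
  proof -
    let ?a = "\<lambda>i. (1/r) * a i" and ?b = "\<lambda>i. (1/r) * b i"
    have p0: "0 < p" using p by simp
    have A: "block_pow p ks ?a \<le> 1" "block_pow p ks ?b \<le> 1"
      using a b r by (simp_all only: sk_norm_le_1_iff[OF p0, symmetric] sk_norm_scale[OF p0]) simp_all
    have "(\<lambda>i. ?a i - ?b i) = (\<lambda>i. (1/r) * (a i - b i))" by (auto simp: diff_divide_distrib)
    then have "1/2 \<le> sk_norm p ks (\<lambda>i. ?a i - ?b i)"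
      using ab r by (simp only: sk_norm_scale[OF p0]) (simp add: field_simps)
    then have "(1/2) powr p \<le> sk_norm p ks (\<lambda>i. ?a i - ?b i) powr p" using p by (intro powr_mono2) auto
    then have "(1/2) powr p \<le> block_pow p ks (\<lambda>i. ?a i - ?b i)" by (simp add: sk_norm_powr[OF p0])
    from uc[OF A this] have "block_pow p ks (\<lambda>i. (?a i + ?b i) / 2) \<le> 1 - \<delta> / 2" using d by simp
    then have "sk_norm p ks (\<lambda>i. (?a i + ?b i) / 2) \<le> \<theta>"
      unfolding sk_norm_block_pow \<theta>_def using p block_pow_nonneg by (intro powr_mono2) auto
    moreover have "(\<lambda>i. (?a i + ?b i) / 2) = (\<lambda>i. (1/r) * ((a i + b i) / 2))" by (auto simp: add_divide_distrib)
    ultimately have "(1/r) * sk_norm p ks (\<lambda>i. (a i + b i) / 2) \<le> \<theta>" 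
      using r by (simp only: sk_norm_scale[OF p0]) simp
    then show ?thesis using r by (simp add: field_simps)
  qed
  then show ?thesis using th by blast
qed

section \<open>Volumes of superballs\<close>

interpretation lborel_family: product_sigma_finite "\<lambda>_::nat. lborel :: real measure"
  by standard

lemma space_lebn: "space (lebn n) = Rn n"
  by (simp add: lebn_def Rn_def space_PiM)

lemma emeasure_lborel_affine_vimage:
  fixes c t :: real
  assumes "0 < c" "A \<in> sets lborel"
  shows "emeasure lborel A = ennreal c * emeasure lborel ((\<lambda>s. t + c * s) -` A)"
proof -
  have "emeasure lborel A = emeasure (density (distr lborel borel (\<lambda>x. t + c * x)) (\<lambda>_. ennreal (abs c))) A"
    using lborel_real_affine[of c t] assms by simp
  also have "\<dots> = ennreal c * emeasure (distr lborel borel (\<lambda>x. t + c * x)) A"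
    using assms by (simp add: emeasure_density nn_integral_cmult_indicator)
  also have "\<dots> = ennreal c * emeasure lborel ((\<lambda>s. t + c * s) -` A)"
    using assms by (simp add: emeasure_distr)
  finally show ?thesis .
qed

text \<open>The transported and rescaled measure agrees with the product measure on boxes, where the
  one-dimensional formula applies to each factor; uniqueness of the product measure extends this to
  all measurable sets.\<close>

lemma emeasure_lebn_affine_vimage:
  assumes c: "0 < c" and A: "A \<in> sets (lebn n)"
  shows "emeasure (lebn n) A =
    ennreal (c ^ n) * emeasure (lebn n) ((\<lambda>y. \<lambda>i\<in>{..<n}. x i + c * y i) -` A \<inter> space (lebn n))"
proof -
  define T where "T = (\<lambda>y::nat \<Rightarrow> real. \<lambda>i\<in>{..<n}. x i + c * y i)"
  have T[measurable]: "T \<in> lebn n \<rightarrow>\<^sub>M lebn n"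
    unfolding T_def lebn_def by measurable
  define M where "M = density (distr (lebn n) (lebn n) T) (\<lambda>_. ennreal (c ^ n))"
  have eM: "emeasure M B = ennreal (c ^ n) * emeasure (lebn n) (T -` B \<inter> space (lebn n))"
    if "B \<in> sets (lebn n)" for B
    using that by (simp add: M_def emeasure_density nn_integral_cmult_indicator emeasure_distr)
  have "M = PiM {..<n} (\<lambda>_. lborel)"
  proof (rule lborel_family.PiM_eqI)
    show "sets M = sets (PiM {..<n} (\<lambda>_. lborel))" by (simp add: M_def lebn_def)
    fix B :: "nat \<Rightarrow> real set" assume B: "\<And>i. i \<in> {..<n} \<Longrightarrow> B i \<in> sets lborel"
    have 1: "T -` (Pi\<^sub>E {..<n} B) \<inter> space (lebn n) = Pi\<^sub>E {..<n} (\<lambda>i. (\<lambda>s. x i + c * s) -` B i)"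
      by (auto simp: T_def space_lebn Rn_def PiE_iff extensional_def)
    have 2: "(\<lambda>s. x i + c * s) -` B i \<in> sets lborel" if "i < n" for i
      using measurable_sets[of "\<lambda>s. x i + c * s" lborel lborel "B i"] B that by simp
    have "emeasure M (Pi\<^sub>E {..<n} B) = ennreal (c ^ n) * emeasure (lebn n) (Pi\<^sub>E {..<n} (\<lambda>i. (\<lambda>s. x i + c * s) -` B i))"
      unfolding 1[symmetric] by (rule eM) (use B in \<open>auto simp: lebn_def intro!: sets_PiM_I_finite\<close>)
    also have "\<dots> = (\<Prod>i<n. ennreal c) * (\<Prod>i<n. emeasure lborel ((\<lambda>s. x i + c * s) -` B i))"
    proof -
      have "emeasure (lebn n) (Pi\<^sub>E {..<n} (\<lambda>i. (\<lambda>s. x i + c * s) -` B i))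
          = (\<Prod>i<n. emeasure lborel ((\<lambda>s. x i + c * s) -` B i))"
        unfolding lebn_def using 2 by (intro lborel_family.emeasure_PiM) auto
      then show ?thesis using c by (simp add: ennreal_power)
    qed
    also have "\<dots> = (\<Prod>i<n. emeasure lborel (B i))"
      unfolding prod.distrib[symmetric]
      by (intro prod.cong refl emeasure_lborel_affine_vimage[symmetric] c B) auto
    finally show "emeasure M (Pi\<^sub>E {..<n} B) = (\<Prod>i<n. emeasure lborel (B i))" .
  qed simp
  then have "M = lebn n" by (simp add: lebn_def)
  then show ?thesis using eM[OF A] by (simp add: T_def)
qed

section \<open>Block vectors and the coordinates that the norm reads\<close>

lemma valid_k_nth:
  assumes "valid_k n ks"
  shows "2 \<le> length ks" "ks ! 0 = 0" "ks ! (length ks - 1) = n"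
  using assms hd_conv_nth[of ks] last_conv_nth[of ks] by (cases "ks = []"; simp add: valid_k_def)+

lemma valid_k_nth_less:
  assumes "valid_k n ks" "i < j" "j < length ks"
  shows "ks ! i < ks ! j"
  using assms by (intro sorted_wrt_nth_less[of "(<)"]) (auto simp: valid_k_def)

lemma valid_k_block_le:
  assumes "valid_k n ks" "j < length ks"
  shows "ks ! j \<le> n"
proof (cases "j = length ks - 1")
  case False
  then have "ks ! j < ks ! (length ks - 1)" using assms by (intro valid_k_nth_less) auto
  then show ?thesis using valid_k_nth[OF assms(1)] by simp
qed (use valid_k_nth[OF assms(1)] in simp)

lemma valid_k_cover:
  assumes k: "valid_k n ks" and i: "i < n"
  shows "\<exists>j<length ks - 1. ks ! j \<le> i \<and> i < ks ! (j + 1)"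
proof -
  \<comment> \<open>The block containing \<open>i\<close> starts at the last entry not exceeding
    \<open>i\<close>; this is not the final entry, which is \<open>n\<close>.\<close>
  define j where "j = (GREATEST j. j < length ks \<and> ks ! j \<le> i)"
  have z: "0 < length ks \<and> ks ! 0 \<le> i"
    using valid_k_nth[OF k] by auto
  have j: "j < length ks \<and> ks ! j \<le> i"
    unfolding j_def by (rule GreatestI_nat[of _ 0 "length ks"]) (use z in auto)
  have g: "j' \<le> j" if "j' < length ks" "ks ! j' \<le> i" for j'
    unfolding j_def by (rule Greatest_le_nat[where b="length ks"]) (use that in auto)
  have "j \<noteq> length ks - 1" using j i valid_k_nth(3)[OF k] by auto
  then have lt: "j < length ks - 1" using j by auto
  then have "j + 1 < length ks" by simp
  then have "i < ks ! (j + 1)" using g[of "j + 1"] by linarith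
  then show ?thesis using lt j by blast
qed

lemma valid_k_pos: "valid_k n ks \<Longrightarrow> 0 < n"
  using valid_k_nth[of n ks] valid_k_nth_less[of n ks 0 "length ks - 1"] by simp

text \<open>Pointwise sums and differences of extensional functions need not be extensional, so
  vectors are compared through their first \<open>n\<close> coordinates.\<close>

lemma sk_norm_cong:
  assumes k: "valid_k n ks" and eq: "\<And>i. i < n \<Longrightarrow> x i = y i"
  shows "sk_norm p ks x = sk_norm p ks y"
proof -
  have "block_pow p ks x = block_pow p ks y"
    unfolding block_pow_def
  proof (intro sum.cong refl)
    fix j assume "j \<in> {..<length ks - 1}"
    then have "ks ! (j + 1) \<le> n" by (intro valid_k_block_le[OF k]) auto
    then have "L2_set x {ks ! j..<ks ! (j + 1)} = L2_set y {ks ! j..<ks ! (j + 1)}"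
      by (intro L2_set_cong refl eq) auto
    then show "L2_set x {ks ! j..<ks ! (j + 1)} powr p = L2_set y {ks ! j..<ks ! (j + 1)} powr p" by simp
  qed
  then show ?thesis by (simp add: sk_norm_block_pow)
qed

lemma abs_coord_le_sk_norm:
  assumes k: "valid_k n ks" and i: "i < n" and p: "p > 0"
  shows "\<bar>x i\<bar> \<le> sk_norm p ks x"
proof -
  obtain j where j: "j < length ks - 1" "ks ! j \<le> i" "i < ks ! (j + 1)"
    using valid_k_cover[OF k i] by blast
  let ?A = "{ks ! j..<ks ! (j + 1)}"
  have "\<bar>x i\<bar> \<le> L2_set (\<lambda>i. \<bar>x i\<bar>) ?A" using j by (intro member_le_L2_set) auto
  also have "\<dots> = L2_set x ?A" by (simp add: L2_set_def)
  finally have "\<bar>x i\<bar> powr p \<le> L2_set x ?A powr p" using p by (intro powr_mono2) auto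
  also have "\<dots> \<le> block_pow p ks x"
    unfolding block_pow_def using j by (intro member_le_sum[where i=j]) auto
  finally have "(\<bar>x i\<bar> powr p) powr (1/p) \<le> sk_norm p ks x"
    unfolding sk_norm_block_pow using p by (intro powr_mono2) auto
  then show ?thesis using p by (simp add: powr_powr)
qed

section \<open>Measurability, scaling and the radius of volume one\<close>

lemma sk_norm_measurable:
  assumes k: "valid_k n ks"
  shows "(\<lambda>y. sk_norm p ks (\<lambda>i. y i - x i)) \<in> borel_measurable (lebn n)"
proof -
  have comp: "(\<lambda>y. y i) \<in> borel_measurable (lebn n)"
    if "j \<in> {..<length ks - 1}" "i \<in> {ks ! j..<ks ! (j + 1)}" for i j
  proof -
    have "ks ! (j + 1) \<le> n" using that by (intro valid_k_block_le[OF k]) auto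
    then have "i \<in> {..<n}" using that by simp
    then show ?thesis using measurable_component_singleton[of i "{..<n}" "\<lambda>_. lborel :: real measure"]
      by (simp add: lebn_def)
  qed
  show ?thesis unfolding sk_norm_def
    by (intro powr_real_measurable borel_measurable_sum borel_measurable_const
        measurable_compose[OF _ borel_measurable_sqrt] borel_measurable_power borel_measurable_diff)
       (rule comp)
qed

lemma superball_sets:
  assumes "valid_k n ks"
  shows "superball n p ks x r \<in> sets (lebn n)"
proof -
  have "superball n p ks x r = {y \<in> space (lebn n). sk_norm p ks (\<lambda>i. y i - x i) \<le> r}"
    by (simp add: superball_def space_lebn)
  also have "\<dots> \<in> sets (lebn n)" using sk_norm_measurable[OF assms] by measurable
  finally show ?thesis .
qed

lemma emeasure_superball_scale:
  assumes k: "valid_k n ks" and p: "p > 0" and r: "0 < r"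
  shows "emeasure (lebn n) (superball n p ks x r) =
    ennreal (r ^ n) * emeasure (lebn n) (superball n p ks (\<lambda>_. 0) 1)"
proof -
  have "(\<lambda>y. \<lambda>i\<in>{..<n}. x i + r * y i) -` superball n p ks x r \<inter> space (lebn n) = superball n p ks (\<lambda>_. 0) 1"
  proof -
    have "sk_norm p ks (\<lambda>i. (\<lambda>i\<in>{..<n}. x i + r * y i) i - x i) = r * sk_norm p ks y" for y
    proof -
      have "sk_norm p ks (\<lambda>i. (\<lambda>i\<in>{..<n}. x i + r * y i) i - x i) = sk_norm p ks (\<lambda>i. r * y i)"
        by (intro sk_norm_cong[OF k]) auto
      then show ?thesis using sk_norm_scale[OF p, of ks r y] r by simp
    qed
    then show ?thesis using r by (auto simp: superball_def space_lebn Rn_def)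
  qed
  then show ?thesis
    using emeasure_lebn_affine_vimage[OF r superball_sets[OF k], of p x r x] by simp
qed

text \<open>A null unit ball would by scaling make all balls of integer radius null, although they
  cover the whole space. Finiteness comes from a cube around the ball.\<close>

lemma emeasure_unit_superball:
  assumes k: "valid_k n ks" and p: "p > 0"
  shows "0 < emeasure (lebn n) (superball n p ks (\<lambda>_. 0) 1)"
    and "emeasure (lebn n) (superball n p ks (\<lambda>_. 0) 1) < \<infinity>"
proof -
  have "superball n p ks (\<lambda>_. 0) 1 \<subseteq> Pi\<^sub>E {..<n} (\<lambda>_. {-1..1})"
  proof
    fix y assume y: "y \<in> superball n p ks (\<lambda>_. 0) 1"
    then have "\<bar>y i\<bar> \<le> 1" if "i < n" for i
      using abs_coord_le_sk_norm[OF k that p, of y] by (simp add: superball_def)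
    then have "y i \<in> {-1..1}" if "i < n" for i using that by (simp add: abs_le_iff)
    then show "y \<in> Pi\<^sub>E {..<n} (\<lambda>_. {-1..1})" using y by (simp add: superball_def Rn_def PiE_iff)
  qed
  then have "emeasure (lebn n) (superball n p ks (\<lambda>_. 0) 1) \<le> emeasure (lebn n) (Pi\<^sub>E {..<n} (\<lambda>_. {-1..1}))"
    by (intro emeasure_mono) (auto simp: lebn_def intro!: sets_PiM_I_finite)
  also have "\<dots> = (\<Prod>i<n. 2)" by (simp add: lebn_def lborel_family.emeasure_PiM)
  also have "\<dots> < \<infinity>" by (simp add: ennreal_power[symmetric] power_less_top_ennreal)
  finally show "emeasure (lebn n) (superball n p ks (\<lambda>_. 0) 1) < \<infinity>" .
  show "0 < emeasure (lebn n) (superball n p ks (\<lambda>_. 0) 1)"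
  proof (rule ccontr)
    assume "\<not> ?thesis"
    then have z: "emeasure (lebn n) (superball n p ks (\<lambda>_. 0) 1) = 0" by simp
    have "superball n p ks (\<lambda>_. 0) (real (Suc m)) \<in> null_sets (lebn n)" for m
      using emeasure_superball_scale[OF k p, of "real (Suc m)" "\<lambda>_. 0"] z superball_sets[OF k]
      by (intro null_setsI) auto
    then have "(\<Union>m. superball n p ks (\<lambda>_. 0) (real (Suc m))) \<in> null_sets (lebn n)"
      by (intro null_sets_UN) auto
    moreover have "(\<Union>m. superball n p ks (\<lambda>_. 0) (real (Suc m))) = Rn n"
    proof -
      have "\<exists>m. sk_norm p ks y \<le> real (Suc m)" for y
      proof -
        obtain m where "sk_norm p ks y \<le> real m" using real_arch_simple by blast
        then have "sk_norm p ks y \<le> real (Suc m)" by simp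
        then show ?thesis by blast
      qed
      then show ?thesis by (auto simp: superball_def)
    qed
    ultimately have "emeasure (lebn n) (Rn n) = 0" by auto
    moreover have "emeasure (lebn n) (Rn n) = (\<Prod>i<n. \<infinity>)"
      unfolding lebn_def Rn_def by (subst lborel_family.emeasure_PiM) auto
    ultimately show False by simp
  qed
qed

text \<open>The definite description in \<open>unit_radius\<close> is meaningful: by scaling, volume
  1 amounts to \<open>r ^ n * v = 1\<close>, which has exactly one positive solution because
  \<open>n\<close> is positive.\<close>

lemma unit_radius:
  assumes k: "valid_k n ks" and p: "p > 0"
  shows "0 < unit_radius n p ks"
    and "emeasure (lebn n) (superball n p ks (\<lambda>_. 0) (unit_radius n p ks)) = 1"
proof -
  define v where "v = measure (lebn n) (superball n p ks (\<lambda>_. 0) 1)"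
  have ev: "emeasure (lebn n) (superball n p ks (\<lambda>_. 0) 1) = ennreal v" and v: "0 < v"
  proof -
    note b = emeasure_unit_superball[OF k p]
    show ev: "emeasure (lebn n) (superball n p ks (\<lambda>_. 0) 1) = ennreal v"
      unfolding v_def using b(2) by (intro emeasure_eq_ennreal_measure) auto
    show "0 < v" using b(1) unfolding ev by simp
  qed
  have n: "0 < n" by (rule valid_k_pos[OF k])
  have iff: "emeasure (lebn n) (superball n p ks (\<lambda>_. 0) r) = 1 \<longleftrightarrow> r ^ n * v = 1" if "0 < r" for r
    using that v emeasure_superball_scale[OF k p that, of "\<lambda>_. 0"]
    by (simp add: ev ennreal_mult[symmetric])
  define r where "r = root n (1 / v)"
  have r: "0 < r" "r ^ n * v = 1" using n v by (auto simp: r_def)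
  have "unit_radius n p ks = r"
    unfolding unit_radius_def
  proof (rule the_equality)
    show "0 < r \<and> emeasure (lebn n) (superball n p ks (\<lambda>_. 0) r) = 1" using r iff by simp
    fix t assume t: "0 < t \<and> emeasure (lebn n) (superball n p ks (\<lambda>_. 0) t) = 1"
    then have "t ^ n * v = r ^ n * v" using iff[of t] r(2) by simp
    then have "t ^ n = r ^ n" using v by simp
    then show "t = r" using t r n by (simp add: power_eq_iff_eq_base)
  qed
  then show "0 < unit_radius n p ks" "emeasure (lebn n) (superball n p ks (\<lambda>_. 0) (unit_radius n p ks)) = 1"
    using r iff by auto
qed

text \<open>Measured in unit radii, volumes become pure powers; the later volume estimates all use
  this form.\<close>

lemma emeasure_superball:
  assumes k: "valid_k n ks" and p: "p > 0" and t: "0 < t"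
  shows "emeasure (lebn n) (superball n p ks x (t * unit_radius n p ks)) = ennreal (t ^ n)"
proof -
  let ?u = "unit_radius n p ks" and ?b = "emeasure (lebn n) (superball n p ks (\<lambda>_. 0) 1)"
  note u = unit_radius[OF k p]
  have "emeasure (lebn n) (superball n p ks x (t * ?u)) = ennreal ((t * ?u) ^ n) * ?b"
    using t u by (intro emeasure_superball_scale[OF k p]) simp
  also have "\<dots> = ennreal (t ^ n) * (ennreal (?u ^ n) * ?b)"
    using t u by (simp add: power_mult_distrib ennreal_mult mult.assoc)
  also have "ennreal (?u ^ n) * ?b = 1"
    using emeasure_superball_scale[OF k p u(1), of "\<lambda>_. 0"] u(2) by simp
  finally show ?thesis by simp
qed

section \<open>Independent sets in triangle-free graphs\<close>

text \<open>Complementation in \<open>X\<close> pairs a subset of size k with one of size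
  \<open>card X - k\<close>.\<close>

lemma sum_card_Pow:
  assumes "finite X"
  shows "2 * (\<Sum>Y\<in>Pow X. card Y) = card X * 2 ^ card X"
proof -
  have "(\<Sum>Y\<in>Pow X. card Y) = (\<Sum>Y\<in>Pow X. card (X - Y))"
    by (rule sum.reindex_bij_witness[of _ "\<lambda>Y. X - Y" "\<lambda>Y. X - Y"]) (auto simp: double_diff)
  then have "2 * (\<Sum>Y\<in>Pow X. card Y) = (\<Sum>Y\<in>Pow X. card Y + card (X - Y))"
    by (simp add: sum.distrib)
  also have "\<dots> = (\<Sum>Y\<in>Pow X. card X)"
    using assms by (intro sum.cong refl) (auto simp: card_Diff_subset finite_subset card_mono)
  finally show ?thesis using assms by (simp add: card_Pow)
qed

text \<open>A class with \<open>x\<close> available neighbours of the vertex consists of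
  \<open>2 ^ x + 1\<close> independent sets, whose total weight is at least the right-hand side. For
  \<open>x \<le> s\<close> the one set containing the vertex pays, since
  \<open>s \<le> 2 ^ s\<close>; for larger \<open>x\<close> the average subset size
  \<open>x / 2\<close> pays.\<close>

lemma star_count_bound:
  fixes s x :: nat
  shows "real s / 4 * (2 ^ x + 1) \<le> 4 ^ s + real x * 2 ^ x / 2"
proof (cases "x \<le> s")
  case True
  have "real s \<le> 2 ^ s" using of_nat_less_two_power[of s, where 'a=real] by linarith
  moreover have "(2::real) ^ x + 1 \<le> 2 * 2 ^ s" 
    using power_increasing[OF True, of "2::real"] one_le_power[of "2::real" s] by linarith
  ultimately have "real s / 4 * (2 ^ x + 1) \<le> 2 ^ s / 4 * (2 * 2 ^ s)"
    by (intro mult_mono) auto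
  also have "\<dots> \<le> (4::real) ^ s" by (simp add: power_mult_distrib[symmetric])
  also have "\<dots> \<le> 4 ^ s + real x * 2 ^ x / 2" by simp
  finally show ?thesis .
next
  case False
  have "real s / 4 * (2 ^ x + 1) \<le> real x / 4 * (2 * 2 ^ x)"
    using False by (intro mult_mono) auto
  also have "\<dots> \<le> 4 ^ s + real x * 2 ^ x / 2" by simp
  finally show ?thesis .
qed

definition indep_sets :: "'a set \<Rightarrow> ('a \<Rightarrow> 'a \<Rightarrow> bool) \<Rightarrow> 'a set set" where
  "indep_sets V adj = {W. W \<subseteq> V \<and> (\<forall>x\<in>W. \<forall>y\<in>W. \<not> adj x y)}"

text \<open>Alon's argument: on the class of independent sets with a prescribed trace outside the closed
  neighbourhood of \<open>v\<close>, the average of \<open>4 ^ s [v \<in> W] + |N(v) \<inter> W|\<close> is at least \<open>s / 4\<close>.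
  By triangle-freeness such a class consists of \<open>H \<union> {v}\<close> and all \<open>H \<union> Y\<close> with \<open>Y\<close> in the
  set \<open>X\<close> of neighbours of \<open>v\<close> not adjacent to \<open>H\<close>.\<close>

lemma local_occupancy:
  fixes adj :: "'a \<Rightarrow> 'a \<Rightarrow> bool"
  assumes fin: "finite V" and v: "v \<in> V"
    and sym: "\<And>x y. adj x y \<Longrightarrow> adj y x" and irr: "\<And>x. \<not> adj x x"
    and tri: "\<And>x y z. adj x y \<Longrightarrow> adj y z \<Longrightarrow> \<not> adj x z"
  shows "real s / 4 * card (indep_sets V adj) \<le>
    (\<Sum>W\<in>indep_sets V adj. 4 ^ s * of_bool (v \<in> W) + real (card {w\<in>W. adj v w}))"
proof -
  define I where "I = indep_sets V adj"
  define f where "f W = {w\<in>W. w \<noteq> v \<and> \<not> adj v w}" for W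
  define g where "g W = 4 ^ s * of_bool (v \<in> W) + real (card {w\<in>W. adj v w})" for W
  have finI: "finite I" using fin by (auto simp: I_def indep_sets_def intro: finite_subset[of _ "Pow V"])
  have fib: "real s / 4 * card {W\<in>I. f W = H} \<le> (\<Sum>W\<in>{W\<in>I. f W = H}. g W)" if H: "H \<in> f ` I" for H
  proof -
    define X where "X = {x\<in>V. adj v x \<and> (\<forall>h\<in>H. \<not> adj h x)}"
    have finX: "finite X" using fin by (simp add: X_def)
    have H': "H \<subseteq> V" "\<And>x y. x \<in> H \<Longrightarrow> y \<in> H \<Longrightarrow> \<not> adj x y" "\<And>x. x \<in> H \<Longrightarrow> x \<noteq> v \<and> \<not> adj v x"
      using H by (auto simp: I_def indep_sets_def f_def)
    have eq: "{W\<in>I. f W = H} = insert (insert v H) ((\<lambda>Y. H \<union> Y) ` Pow X)" (is "?L = ?R")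
    proof
      show "?L \<subseteq> ?R"
      proof
        fix W assume W: "W \<in> ?L"
        show "W \<in> ?R"
        \<comment> \<open>An independent set containing \<open>v\<close> contains no neighbour of
          \<open>v\<close>, so its trace determines it.\<close>
        proof (cases "v \<in> W")
          case True
          then have "W = insert v H" using W by (auto simp: f_def I_def indep_sets_def)
          then show ?thesis by simp
        next
          case False
          then have "W = H \<union> {w\<in>W. adj v w}" using W by (auto simp: f_def)
          moreover have "{w\<in>W. adj v w} \<subseteq> X" using W by (auto simp: X_def f_def I_def indep_sets_def)
          ultimately show ?thesis by blast
        qed
      qed
      show "?R \<subseteq> ?L"
      proof
        fix W assume "W \<in> ?R"
        then consider "W = insert v H" | Y where "Y \<subseteq> X" "W = H \<union> Y" by blast
        then show "W \<in> ?L"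
        proof cases
          case 1
          have "\<not> adj x v" if "x \<in> H" for x using H'(3)[OF that] sym[of x v] by blast
          moreover have "v \<notin> H" using H'(3) by blast
          ultimately show ?thesis using 1 H'(1,3) H'(2) v irr
            by (simp add: I_def indep_sets_def f_def) blast
        next
          case 2
          have h1: "\<not> adj x y" if "x \<in> H" "y \<in> X" for x y using that by (simp add: X_def)
          \<comment> \<open>Both points are neighbours of \<open>v\<close>; here triangle-freeness
            enters.\<close>
          have h2: "\<not> adj x y" if "x \<in> X" "y \<in> X" for x y
            using that tri[of v x y] by (auto simp: X_def)
          have h3: "\<not> adj y x" if "x \<in> H" "y \<in> X" for x y
            using that sym[of y x] by (auto simp: X_def)
          have "\<not> adj x y" if "x \<in> W" "y \<in> W" for x y
          proof -
            have "x \<in> H \<or> x \<in> X" "y \<in> H \<or> y \<in> X" using that 2 by auto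
            then show ?thesis using H'(2)[of x y] h1[of x y] h2[of x y] h3[of y x] by blast
          qed
          then have "W \<in> I" using 2 H'(1) by (auto simp: I_def indep_sets_def X_def)
          moreover have "f W = H" using 2 H'(3) by (auto simp: f_def X_def)
          ultimately show ?thesis by simp
        qed
      qed
    qed
    have vX: "v \<notin> X" using irr by (simp add: X_def)
    have vH: "v \<notin> H" using H' by blast
    have dis: "H \<inter> X = {}" using H' by (auto simp: X_def)
    have inj: "inj_on (\<lambda>Y. H \<union> Y) (Pow X)" using dis by (auto simp: inj_on_def)
    have nin: "insert v H \<notin> (\<lambda>Y. H \<union> Y) ` Pow X" using vX vH by auto
    have c: "card {W\<in>I. f W = H} = Suc (2 ^ card X)"
      unfolding eq using finX nin by (simp add: card_image[OF inj] card_Pow)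
    have gv: "g (insert v H) \<ge> 4 ^ s" by (simp add: g_def)
    have gY: "g (H \<union> Y) = real (card Y)" if "Y \<in> Pow X" for Y
    proof -
      have "v \<notin> H \<union> Y" using that vX vH by auto
      moreover have "{w \<in> H \<union> Y. adj v w} = Y" using that H' by (auto simp: X_def)
      ultimately show ?thesis by (simp add: g_def)
    qed
    have "(\<Sum>W\<in>{W\<in>I. f W = H}. g W) = g (insert v H) + (\<Sum>Y\<in>Pow X. g (H \<union> Y))"
      unfolding eq using finX nin by (simp add: sum.reindex[OF inj])
    also have "(\<Sum>Y\<in>Pow X. g (H \<union> Y)) = real (\<Sum>Y\<in>Pow X. card Y)" using gY by simp
    also have "\<dots> = real (card X) * 2 ^ card X / 2"
    proof -
      have "real (2 * (\<Sum>Y\<in>Pow X. card Y)) = real (card X * 2 ^ card X)"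
        by (simp only: sum_card_Pow[OF finX])
      then show ?thesis by simp
    qed
    finally show ?thesis using star_count_bound[of s "card X"] gv c by (simp add: algebra_simps)
  qed
  have "real s / 4 * real (card I) = (\<Sum>H\<in>f ` I. real s / 4 * card {W\<in>I. f W = H})"
  proof -
    have "real (card I) = (\<Sum>W\<in>I. 1)" by simp
    also have "\<dots> = (\<Sum>H\<in>f ` I. \<Sum>W\<in>{W\<in>I. f W = H}. 1)" by (rule sum.image_gen[OF finI])
    finally show ?thesis by (simp add: sum_distrib_left)
  qed
  also have "\<dots> \<le> (\<Sum>H\<in>f ` I. \<Sum>W\<in>{W\<in>I. f W = H}. g W)" by (intro sum_mono fib)
  also have "\<dots> = (\<Sum>W\<in>I. g W)" by (rule sum.image_gen[OF finI, symmetric])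
  finally show ?thesis by (simp add: I_def g_def)
qed

text \<open>Double counting: the occupancy bound is summed over all \<open>v\<close> and the sums
  are exchanged. An independent set \<open>W\<close> then receives at most \<open>4 ^ s\<close> per
  element from membership and at most \<open>4 ^ s\<close> per element from the degrees, so the
  average size of \<open>W\<close> is large enough.\<close>

lemma triangle_free_indep_set:
  fixes adj :: "'a \<Rightarrow> 'a \<Rightarrow> bool"
  assumes fin: "finite V"
    and sym: "\<And>x y. adj x y \<Longrightarrow> adj y x" and irr: "\<And>x. \<not> adj x x"
    and tri: "\<And>x y z. adj x y \<Longrightarrow> adj y z \<Longrightarrow> \<not> adj x z"
    and deg: "\<And>v. v \<in> V \<Longrightarrow> card {w\<in>V. adj v w} \<le> 4 ^ s"
  shows "\<exists>W\<subseteq>V. (\<forall>x\<in>W. \<forall>y\<in>W. \<not> adj x y) \<and> real s * real (card V) \<le> 8 * 4 ^ s * real (card W)"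
proof -
  define I where "I = indep_sets V adj"
  have finI: "finite I" using fin by (auto simp: I_def indep_sets_def intro: finite_subset[of _ "Pow V"])
  have "{} \<in> I" by (simp add: I_def indep_sets_def)
  then have ne: "I \<noteq> {}" by blast
  have up: "(\<Sum>v\<in>V. 4 ^ s * of_bool (v \<in> W) + real (card {w\<in>W. adj v w})) \<le> 2 * 4 ^ s * real (card W)"
    if W: "W \<in> I" for W
  proof -
    have WV: "W \<subseteq> V" using W by (simp add: I_def indep_sets_def)
    have finW: "finite W" using WV fin finite_subset by blast
    have "(\<Sum>v\<in>V. (4::real) ^ s * of_bool (v \<in> W)) = 4 ^ s * real (card W)"
    proof -
      have "(\<Sum>v\<in>V. (4::real) ^ s * of_bool (v \<in> W)) = (\<Sum>v\<in>W. 4 ^ s)"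
        using WV fin by (intro sum.mono_neutral_cong_right) auto
      then show ?thesis by simp
    qed
    moreover have "(\<Sum>v\<in>V. real (card {w\<in>W. adj v w})) = (\<Sum>w\<in>W. real (card {v\<in>V. adj v w}))"
    proof -
      have "(\<Sum>v\<in>V. card {w\<in>W. adj v w}) = (\<Sum>w\<in>W. card {v\<in>V. adj v w})"
        by (rule sum_multicount_gen) (use fin finW in auto)
      then show ?thesis unfolding of_nat_sum[symmetric] by simp
    qed
    moreover have "(\<Sum>w\<in>W. real (card {v\<in>V. adj v w})) \<le> (\<Sum>w\<in>W. 4 ^ s)"
    proof (rule sum_mono)
      fix w assume "w \<in> W"
      moreover have "{v\<in>V. adj v w} = {v\<in>V. adj w v}" using sym[of w] sym[of _ w] by blast
      ultimately have "card {v\<in>V. adj v w} \<le> 4 ^ s" using deg[of w] WV by auto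
      then show "real (card {v\<in>V. adj v w}) \<le> 4 ^ s" using of_nat_mono by fastforce
    qed
    ultimately show ?thesis by (simp add: sum.distrib)
  qed
  have "real s / 4 * real (card V) * real (card I) = (\<Sum>v\<in>V. real s / 4 * real (card I))" by simp
  also have "\<dots> \<le> (\<Sum>v\<in>V. \<Sum>W\<in>I. 4 ^ s * of_bool (v \<in> W) + real (card {w\<in>W. adj v w}))"
    unfolding I_def
  proof (rule sum_mono)
    fix v assume "v \<in> V"
    from local_occupancy[of V v adj, OF fin this sym irr tri]
    show "real s / 4 * real (card (indep_sets V adj)) \<le>
      (\<Sum>W\<in>indep_sets V adj. 4 ^ s * of_bool (v \<in> W) + real (card {w\<in>W. adj v w}))" .
  qed
  also have "\<dots> = (\<Sum>W\<in>I. \<Sum>v\<in>V. 4 ^ s * of_bool (v \<in> W) + real (card {w\<in>W. adj v w}))"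
    by (rule sum.swap)
  also have "\<dots> \<le> (\<Sum>W\<in>I. 2 * 4 ^ s * real (card W))" by (intro sum_mono up)
  finally have le: "real s / 4 * real (card V) * real (card I) \<le> (\<Sum>W\<in>I. 2 * 4 ^ s * real (card W))" .
  have "\<exists>W\<in>I. real s / 4 * real (card V) \<le> 2 * 4 ^ s * real (card W)"
  proof (rule ccontr)
    assume "\<not> ?thesis"
    then have "(\<Sum>W\<in>I. 2 * 4 ^ s * real (card W)) < (\<Sum>W\<in>I. real s / 4 * real (card V))"
      using finI ne by (intro sum_strict_mono) auto
    also have "\<dots> = real s / 4 * real (card V) * real (card I)" by simp
    finally show False using le by simp
  qed
  then obtain W where "W \<in> I" "real s * real (card V) \<le> 8 * 4 ^ s * real (card W)" by auto
  then show ?thesis by (auto simp: I_def indep_sets_def)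
qed

text \<open>The average degree is at most \<open>4 ^ s / 2\<close>, so at most half of the vertices have degree above
  \<open>4 ^ s\<close>; these are dropped.\<close>

lemma back_degree_indep_set:
  fixes adj :: "nat \<Rightarrow> nat \<Rightarrow> bool"
  assumes sym: "\<And>x y. adj x y \<Longrightarrow> adj y x" and irr: "\<And>x. \<not> adj x x"
    and tri: "\<And>i j k. k < N \<Longrightarrow> i < j \<Longrightarrow> j < k \<Longrightarrow> adj i j \<Longrightarrow> adj j k \<Longrightarrow> \<not> adj i k"
    and bdeg: "\<And>k. k < N \<Longrightarrow> 4 * real (card {i. i < k \<and> adj i k}) \<le> 4 ^ s"
  shows "\<exists>W\<subseteq>{..<N}. (\<forall>x\<in>W. \<forall>y\<in>W. \<not> adj x y) \<and> real s * real N \<le> 16 * 4 ^ s * real (card W)"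
proof -
  define dg where "dg v = card {w\<in>{..<N}. adj v w}" for v
  define V where "V = {v\<in>{..<N}. dg v \<le> 4 ^ s}"
  have split: "dg v = card {w. w < v \<and> adj w v} + card {w\<in>{..<N}. v < w \<and> adj v w}" if "v < N" for v
  proof -
    have "{w\<in>{..<N}. adj v w} = {w. w < v \<and> adj w v} \<union> {w\<in>{..<N}. v < w \<and> adj v w}"
    proof (rule set_eqI)
      fix w
      show "w \<in> {w\<in>{..<N}. adj v w} \<longleftrightarrow> w \<in> {w. w < v \<and> adj w v} \<union> {w\<in>{..<N}. v < w \<and> adj v w}"
      proof (cases "adj v w")
        case True
        then have "adj w v" "w \<noteq> v" using sym[of v w] irr[of v] by blast+
        then show ?thesis using True \<open>v < N\<close> by auto
      next
        case False
        then have "\<not> adj w v" using sym[of w v] by blast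
        then show ?thesis using False by auto
      qed
    qed
    then have "dg v = card ({w. w < v \<and> adj w v} \<union> {w\<in>{..<N}. v < w \<and> adj v w})"
      unfolding dg_def by (rule arg_cong)
    also have "\<dots> = card {w. w < v \<and> adj w v} + card {w\<in>{..<N}. v < w \<and> adj v w}"
      by (rule card_Un_disjoint) auto
    finally show ?thesis .
  qed
  have swap: "(\<Sum>v<N. card {w\<in>{..<N}. v < w \<and> adj v w}) = (\<Sum>w<N. card {v. v < w \<and> adj v w})"
  proof -
    have "(\<Sum>v<N. card {w\<in>{..<N}. v < w \<and> adj v w}) = (\<Sum>w<N. card {v\<in>{..<N}. v < w \<and> adj v w})"
      by (rule sum_multicount_gen) auto
    also have "\<dots> = (\<Sum>w<N. card {v. v < w \<and> adj v w})"
      by (intro sum.cong refl arg_cong[where f=card]) auto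
    finally show ?thesis .
  qed
  \<comment> \<open>Every edge is seen forward from its smaller end and backward from its larger
    one; backward degrees at most \<open>4 ^ s / 4\<close> thus give average degree at most
    \<open>4 ^ s / 2\<close>.\<close>
  have "(\<Sum>v<N. dg v) = (\<Sum>v<N. card {w. w < v \<and> adj w v} + card {w\<in>{..<N}. v < w \<and> adj v w})"
    by (intro sum.cong refl split) simp
  also have "\<dots> = 2 * (\<Sum>v<N. card {w. w < v \<and> adj w v})"
    unfolding sum.distrib swap by simp
  finally have "2 * real (\<Sum>v<N. dg v) = (\<Sum>v<N. 4 * real (card {w. w < v \<and> adj w v}))"
    by (simp add: sum_distrib_left)
  also have "\<dots> \<le> (\<Sum>v<N. 4 ^ s)" by (intro sum_mono bdeg) simp
  finally have tot: "2 * real (\<Sum>v<N. dg v) \<le> 4 ^ s * real N" by (simp add: mult.commute)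
  have "4 ^ s * real (card ({..<N} - V)) = (\<Sum>v\<in>{..<N} - V. 4 ^ s)" by simp
  also have "\<dots> \<le> (\<Sum>v\<in>{..<N} - V. real (dg v))"
  proof (rule sum_mono)
    fix v assume "v \<in> {..<N} - V"
    then have "4 ^ s \<le> dg v" by (auto simp: V_def)
    then show "4 ^ s \<le> real (dg v)" using of_nat_mono by fastforce
  qed
  also have "\<dots> \<le> (\<Sum>v<N. real (dg v))" by (rule sum_mono2) auto
  finally have "4 ^ s * (2 * real (card ({..<N} - V))) \<le> 4 ^ s * real N"
    using tot unfolding of_nat_sum by linarith
  then have "2 * real (card ({..<N} - V)) \<le> real N" by simp
  moreover have VN: "V \<subseteq> {..<N}" by (auto simp: V_def)
  then have "real (card ({..<N} - V)) = real N - real (card V)"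
    using card_mono[OF _ VN] by (subst card_Diff_subset) (auto intro: finite_subset)
  ultimately have half: "real N \<le> 2 * card V" by simp
  \<comment> \<open>\<open>tri\<close> speaks of increasing triples below \<open>N\<close> only;
    cutting the relation down to these vertices makes it triangle-free everywhere.\<close>
  define adj' where "adj' x y \<longleftrightarrow> adj x y \<and> x < N \<and> y < N" for x y
  have "\<exists>W\<subseteq>V. (\<forall>x\<in>W. \<forall>y\<in>W. \<not> adj' x y) \<and> real s * real (card V) \<le> 8 * 4 ^ s * real (card W)"
  proof (rule triangle_free_indep_set)
    show "finite V" using VN finite_subset by blast
    show "adj' y x" if "adj' x y" for x y using that sym[of x y] unfolding adj'_def by blast
    show "\<not> adj' x x" for x using irr by (simp add: adj'_def)
    show "\<not> adj' x z" if "adj' x y" "adj' y z" for x y z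
    proof
      assume "adj' x z"
      with that have a: "adj x y" "adj y z" "adj x z" "x < N" "y < N" "z < N"
        unfolding adj'_def by auto
      note b = sym[OF a(1)] sym[OF a(2)] sym[OF a(3)]
      have "x \<noteq> y" "y \<noteq> z" "x \<noteq> z" using a(1-3) irr by blast+
      then have "x < y \<or> y < x" "y < z \<or> z < y" "x < z \<or> z < x" by linarith+
      then show False
        using a b tri[of z x y] tri[of y x z] tri[of z y x] tri[of x y z] tri[of x z y] tri[of y z x]
        by blast
    qed
    show "card {w\<in>V. adj' v w} \<le> 4 ^ s" if "v \<in> V" for v
    proof -
      have "card {w\<in>V. adj' v w} \<le> dg v" unfolding dg_def using VN by (intro card_mono) (auto simp: adj'_def)
      then show ?thesis using that by (simp add: V_def)
    qed
  qed
  then obtain W where W: "W \<subseteq> V" "\<forall>x\<in>W. \<forall>y\<in>W. \<not> adj' x y" "real s * real (card V) \<le> 8 * 4 ^ s * real (card W)" by blast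
  have "real s * real N \<le> real s * (2 * card V)" using half by (intro mult_left_mono) auto
  also have "\<dots> \<le> 16 * 4 ^ s * real (card W)" using W(3) by (simp add: algebra_simps)
  finally show ?thesis using W VN by (intro exI[of _ W]) (auto simp: adj'_def)
qed

section \<open>Greedy choice of points\<close>

text \<open>Points are chosen one at a time: the new point avoids the sets \<open>Cl\<close> of all earlier
  points, avoids the common neighbourhood of the ends of every earlier edge, and lies in at most \<open>K\<close>
  earlier neighbourhoods. Each requirement excludes at most a quarter of the volume, the last one by
  Markov's inequality.\<close>

lemma greedy_points:
  fixes M :: "'a measure" and Nb Cl :: "'a \<Rightarrow> 'a set"
  assumes S: "S \<in> sets M" "emeasure M S = ennreal V" "0 < V"
    and Nb: "\<And>x. x \<in> S \<Longrightarrow> Nb x \<in> sets M" "\<And>x. x \<in> S \<Longrightarrow> emeasure M (Nb x) \<le> ennreal D"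
    and Cl: "\<And>x. x \<in> S \<Longrightarrow> Cl x \<in> sets M" "\<And>x. x \<in> S \<Longrightarrow> emeasure M (Cl x) \<le> ennreal d"
    and lens: "\<And>x y. x \<in> S \<Longrightarrow> y \<in> S \<Longrightarrow> y \<in> Nb x \<Longrightarrow> y \<notin> Cl x \<Longrightarrow>
        emeasure M (Nb x \<inter> Nb y) \<le> ennreal q"
    and nonneg: "0 \<le> D" "0 \<le> d" "0 \<le> q" "0 < K"
    and NK: "4 * real N * D \<le> K * V" and Nd: "4 * real N * d \<le> V" and Nq: "4 * (real N * K) * q \<le> V"
  shows "\<exists>x. \<forall>k<N. x k \<in> S \<and> real (card {i. i < k \<and> x k \<in> Nb (x i)}) \<le> K \<and>
    (\<forall>i<k. x k \<notin> Cl (x i)) \<and>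
    (\<forall>i j. i < j \<longrightarrow> j < k \<longrightarrow> x j \<in> Nb (x i) \<longrightarrow> x k \<notin> Nb (x i) \<inter> Nb (x j))"
proof -
  define good where "good x k \<longleftrightarrow> x k \<in> S \<and> real (card {i. i < k \<and> x k \<in> Nb (x i)}) \<le> K \<and>
    (\<forall>i<k. x k \<notin> Cl (x i)) \<and>
    (\<forall>i j. i < j \<longrightarrow> j < k \<longrightarrow> x j \<in> Nb (x i) \<longrightarrow> x k \<notin> Nb (x i) \<inter> Nb (x j))" for x and k :: nat
  have "n \<le> N \<Longrightarrow> \<exists>x. \<forall>k<n. good x k" for n
  proof (induction n)
    case 0
    then show ?case by simp
  next
    case (Suc n)
    then obtain x where x: "\<And>k. k < n \<Longrightarrow> good x k" by auto
    have nN: "real n \<le> real N" using Suc.prems by simp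
    have xS: "x i \<in> S" if "i < n" for i using x[OF that] by (simp add: good_def)
    \<comment> \<open>\<open>c z\<close> counts the earlier neighbourhoods that contain
      \<open>z\<close>; its integral is at most \<open>real n * D\<close>.\<close>
    define c where "c z = (\<Sum>i<n. indicator (Nb (x i)) z :: ennreal)" for z
    define B1 where "B1 = {z \<in> space M. ennreal K \<le> c z}"
    define B2 where "B2 = (\<Union>i<n. Cl (x i))"
    define E where "E = {(i, j). i < j \<and> j < n \<and> x j \<in> Nb (x i)}"
    define B3 where "B3 = (\<Union>e\<in>E. Nb (x (fst e)) \<inter> Nb (x (snd e)))"
    have cm: "c \<in> borel_measurable M"
      unfolding c_def using Nb(1) xS by (intro borel_measurable_sum borel_measurable_indicator) auto
    then have B1s: "B1 \<in> sets M" unfolding B1_def by measurable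
    have cz: "c z = ennreal (real (card {i. i < n \<and> z \<in> Nb (x i)}))" for z
    proof -
      have "c z = (\<Sum>i<n. ennreal (of_bool (z \<in> Nb (x i))))"
        unfolding c_def by (intro sum.cong refl) (simp add: indicator_def)
      also have "\<dots> = ennreal (\<Sum>i<n. of_bool (z \<in> Nb (x i)))" by (rule sum_ennreal) simp
      also have "(\<Sum>i<n. of_bool (z \<in> Nb (x i)) :: real) = (\<Sum>i\<in>{i. i < n \<and> z \<in> Nb (x i)}. 1)"
        by (intro sum.mono_neutral_cong_right) auto
      finally show ?thesis by simp
    qed
    have "ennreal K * emeasure M B1 = (\<integral>\<^sup>+z. ennreal K * indicator B1 z \<partial>M)"
      using B1s by (simp add: nn_integral_cmult_indicator)
    also have "\<dots> \<le> (\<integral>\<^sup>+z. c z \<partial>M)"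
      by (intro nn_integral_mono) (auto simp: B1_def indicator_def)
    also have "\<dots> = (\<Sum>i<n. emeasure M (Nb (x i)))"
      unfolding c_def using Nb(1) xS by (subst nn_integral_sum) auto
    also have "\<dots> \<le> (\<Sum>i<n. ennreal D)" using Nb(2) xS by (intro sum_mono) auto
    also have "\<dots> = ennreal (real n * D)" using nonneg by (simp add: sum_ennreal ennreal_mult ennreal_of_nat_eq_real_of_nat)
    also have "real n * D \<le> K * (V / 4)"
      using NK mult_right_mono[OF nN nonneg(1)] by simp
    then have "ennreal (real n * D) \<le> ennreal K * ennreal (V / 4)"
      using nonneg S(3) by (simp add: ennreal_mult[symmetric] ennreal_leI)
    finally have e1: "emeasure M B1 \<le> ennreal (V / 4)"
      using nonneg by (simp add: ennreal_mult_le_mult_iff)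
    have B2s: "B2 \<in> sets M" unfolding B2_def using Cl(1) xS by auto
    have "emeasure M B2 \<le> (\<Sum>i<n. emeasure M (Cl (x i)))"
      unfolding B2_def using Cl(1) xS by (intro emeasure_subadditive_finite) auto
    also have "\<dots> \<le> (\<Sum>i<n. ennreal d)" using Cl(2) xS by (intro sum_mono) auto
    also have "\<dots> = ennreal (real n * d)" using nonneg by (simp add: sum_ennreal ennreal_mult ennreal_of_nat_eq_real_of_nat)
    also have "\<dots> \<le> ennreal (V / 4)"
      using Nd mult_right_mono[OF nN nonneg(2)] by (intro ennreal_leI) simp
    finally have e2: "emeasure M B2 \<le> ennreal (V / 4)" .
    \<comment> \<open>The edges are sorted by their later end: each vertex has at most
      \<open>K\<close> earlier neighbours, hence there are at most \<open>N * K\<close>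
      edges.\<close>
    have Eeq: "E = (\<Union>j\<in>{..<n}. (\<lambda>i. (i, j)) ` {i. i < j \<and> x j \<in> Nb (x i)})"
      by (auto simp: E_def)
    have finE: "finite E" unfolding Eeq by auto
    have "card E \<le> (\<Sum>j<n. card ((\<lambda>i. (i, j)) ` {i. i < j \<and> x j \<in> Nb (x i)}))"
      unfolding Eeq by (rule card_UN_le) simp
    also have "\<dots> = (\<Sum>j<n. card {i. i < j \<and> x j \<in> Nb (x i)})"
      by (intro sum.cong refl card_image) (simp add: inj_on_def)
    finally have "real (card E) \<le> (\<Sum>j<n. real (card {i. i < j \<and> x j \<in> Nb (x i)}))"
      unfolding of_nat_sum[symmetric] by (simp only: of_nat_le_iff)
    also have "\<dots> \<le> (\<Sum>j<n. K)" using x by (intro sum_mono) (auto simp: good_def)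
    also have "\<dots> \<le> real N * K" using mult_right_mono[OF nN, of K] nonneg by simp
    finally have cE: "real (card E) \<le> real N * K" .
    have Es: "Nb (x (fst e)) \<inter> Nb (x (snd e)) \<in> sets M" if "e \<in> E" for e
      using that Nb(1) xS by (auto simp: E_def)
    have B3s: "B3 \<in> sets M" unfolding B3_def using finE Es by auto
    have "emeasure M B3 \<le> (\<Sum>e\<in>E. emeasure M (Nb (x (fst e)) \<inter> Nb (x (snd e))))"
      unfolding B3_def using Es finE by (intro emeasure_subadditive_finite) auto
    also have "\<dots> \<le> (\<Sum>e\<in>E. ennreal q)"
    proof (rule sum_mono)
      fix e assume "e \<in> E"
      then obtain i j where e: "e = (i, j)" "i < j" "j < n" "x j \<in> Nb (x i)" by (auto simp: E_def)
      \<comment> \<open>Avoiding \<open>Cl\<close> makes \<open>lens\<close> applicable to every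
        edge.\<close>
      then have "x j \<notin> Cl (x i)" using x[of j] by (auto simp: good_def)
      then show "emeasure M (Nb (x (fst e)) \<inter> Nb (x (snd e))) \<le> ennreal q"
        using e lens[of "x i" "x j"] xS by simp
    qed
    also have "\<dots> = ennreal (real (card E) * q)" using nonneg by (simp add: sum_ennreal ennreal_mult ennreal_of_nat_eq_real_of_nat)
    also have "\<dots> \<le> ennreal (V / 4)"
      using Nq mult_right_mono[OF cE nonneg(3)] by (intro ennreal_leI) simp
    finally have e3: "emeasure M B3 \<le> ennreal (V / 4)" .
    have "\<not> S \<subseteq> B1 \<union> B2 \<union> B3"
    proof
      assume "S \<subseteq> B1 \<union> B2 \<union> B3"
      then have "ennreal V \<le> emeasure M (B1 \<union> B2 \<union> B3)"
        using B1s B2s B3s S(2) by (metis emeasure_mono sets.Un)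
      also have "\<dots> \<le> emeasure M B1 + emeasure M B2 + emeasure M B3"
        using B1s B2s B3s by (intro order_trans[OF emeasure_subadditive] add_right_mono emeasure_subadditive) auto
      also have "\<dots> \<le> ennreal (V / 4) + ennreal (V / 4) + ennreal (V / 4)"
        by (intro add_mono e1 e2 e3)
      also have "\<dots> = ennreal (3 * V / 4)" using S(3) by (simp add: ennreal_plus[symmetric] del: ennreal_plus)
      finally show False using S(3) by simp
    qed
    then obtain z where z: "z \<in> S" "z \<notin> B1" "z \<notin> B2" "z \<notin> B3" by blast
    define y where "y = x(n := z)"
    have "z \<in> space M" using z S(1) sets.sets_into_space by blast
    then have "c z < ennreal K" using z(2) by (simp add: B1_def not_le)
    then have cd: "real (card {i. i < n \<and> z \<in> Nb (x i)}) \<le> K"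
      unfolding cz using nonneg by (simp add: ennreal_less_iff)
    have "good y n"
    proof -
      have "{i. i < n \<and> y n \<in> Nb (y i)} = {i. i < n \<and> z \<in> Nb (x i)}" by (auto simp: y_def)
      moreover have "\<forall>i<n. y n \<notin> Cl (y i)" using z(3) by (auto simp: y_def B2_def)
      moreover have "y n \<notin> Nb (y i) \<inter> Nb (y j)" if "i < j" "j < n" "y j \<in> Nb (y i)" for i j
      proof -
        have "(i, j) \<in> E" using that by (auto simp: y_def E_def split: if_splits)
        then have "z \<notin> Nb (x i) \<inter> Nb (x j)" using z(4) by (force simp: B3_def)
        then show ?thesis using that by (simp add: y_def)
      qed
      ultimately show ?thesis using z(1) cd by (simp add: good_def y_def)
    qed
    \<comment> \<open>\<open>good\<close> at \<open>k\<close> reads the sequence only up to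
      \<open>k\<close>, so the new value at \<open>n\<close> does not affect it.\<close>
    moreover have "good y k" if "k < n" for k
    proof -
      have yk: "y i = x i" if "i \<le> k" for i using that \<open>k < n\<close> by (simp add: y_def)
      have "{i. i < k \<and> y k \<in> Nb (y i)} = {i. i < k \<and> x k \<in> Nb (x i)}" by (auto simp: yk)
      then show ?thesis using x[OF that] by (simp add: good_def yk)
    qed
    ultimately have "\<forall>k<Suc n. good y k" by (simp add: less_Suc_eq)
    then show ?case by blast
  qed
  from this[of N] show ?thesis unfolding good_def by simp
qed

section \<open>Packings\<close>

text \<open>The greedy choice is run with \<open>K = 4 ^ s / 4\<close>, neighbourhoods of two unit
  radii, forbidden balls of one unit radius and lens volume \<open>(2 * \<theta>) ^ n\<close>. The
  condition \<open>4 ^ s \<le> 2 ^ n\<close> controls the forbidden balls, and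
  \<open>16 ^ s * \<theta> ^ n \<le> 1\<close> controls the lenses.\<close>

lemma separated_points_exist:
  assumes k: "valid_k n ks" and p: "1 < p" and \<theta>: "0 < \<theta>"
    and uc: "\<And>a b r. 0 < r \<Longrightarrow> sk_norm p ks a \<le> r \<Longrightarrow> sk_norm p ks b \<le> r \<Longrightarrow>
           r / 2 \<le> sk_norm p ks (\<lambda>i. a i - b i) \<Longrightarrow> sk_norm p ks (\<lambda>i. (a i + b i) / 2) \<le> \<theta> * r"
    and s: "(4::real) ^ s \<le> 2 ^ n" "16 ^ s * \<theta> ^ n \<le> 1"
    and T: "0 < T" and N: "16 * 2 ^ n * real N \<le> T ^ n * 4 ^ s"
  defines "u \<equiv> unit_radius n p ks"
  shows "\<exists>P\<subseteq>superball n p ks (\<lambda>_. 0) (T * u). finite P \<and>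
     (\<forall>x\<in>P. \<forall>y\<in>P. x \<noteq> y \<longrightarrow> 2 * u < sk_norm p ks (\<lambda>i. y i - x i)) \<and>
     real s * real N \<le> 16 * 4 ^ s * real (card P)"
proof -
  have p0: "0 < p" using p by simp
  have u: "0 < u" unfolding u_def by (rule unit_radius[OF k p0])
  define S where "S = superball n p ks (\<lambda>_. 0) (T * u)"
  define Nb where "Nb x = superball n p ks x (2 * u)" for x
  define Cl where "Cl x = superball n p ks x (1 * u)" for x
  note vol = emeasure_superball[OF k p0, folded u_def]
  have NV: "real N * 2 ^ n \<le> T ^ n * 4 ^ s / 16" using N by (simp add: mult_ac)
  have "\<exists>x. \<forall>k<N. x k \<in> S \<and> real (card {i. i < k \<and> x k \<in> Nb (x i)}) \<le> 4 ^ s / 4 \<and>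
    (\<forall>i<k. x k \<notin> Cl (x i)) \<and>
    (\<forall>i j. i < j \<longrightarrow> j < k \<longrightarrow> x j \<in> Nb (x i) \<longrightarrow> x k \<notin> Nb (x i) \<inter> Nb (x j))"
  proof (rule greedy_points)
    show "S \<in> sets (lebn n)" "emeasure (lebn n) S = ennreal (T ^ n)" "0 < T ^ n"
      using T by (simp_all add: S_def superball_sets[OF k] vol)
    show "Nb x \<in> sets (lebn n)" "emeasure (lebn n) (Nb x) \<le> ennreal (2 ^ n)"
      "Cl x \<in> sets (lebn n)" "emeasure (lebn n) (Cl x) \<le> ennreal 1" for x
      using vol[of 2 x] vol[of 1 x] by (simp_all add: Nb_def Cl_def superball_sets[OF k])
    show "0 \<le> (2::real) ^ n" "0 \<le> (1::real)" "0 \<le> (2 * \<theta>) ^ n" "0 < (4::real) ^ s / 4" using \<theta> by auto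
    show "4 * real N * 2 ^ n \<le> 4 ^ s / 4 * T ^ n" using NV by (simp add: mult.commute)
    have "real N * 4 ^ s \<le> real N * 2 ^ n" using s by (intro mult_left_mono) auto
    also have "\<dots> \<le> T ^ n / 16 * 4 ^ s" using NV by simp
    finally have N16: "real N \<le> T ^ n / 16" by simp
    then show "4 * real N * 1 \<le> T ^ n" using zero_less_power[OF T, of n] by linarith
    have "4 * (real N * (4 ^ s / 4)) * (2 * \<theta>) ^ n = (real N * 2 ^ n) * (4 ^ s * \<theta> ^ n)"
      by (simp add: power_mult_distrib)
    also have "\<dots> \<le> (T ^ n * 4 ^ s / 16) * (4 ^ s * \<theta> ^ n)"
      using NV \<theta> by (intro mult_right_mono) auto
    also have "\<dots> = T ^ n / 16 * (16 ^ s * \<theta> ^ n)"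
    proof -
      have "(16::real) ^ s = 4 ^ s * 4 ^ s" by (simp add: power_mult_distrib[symmetric])
      then show ?thesis by (simp only:) simp
    qed
    also have "\<dots> \<le> T ^ n / 16 * 1" using s T by (intro mult_left_mono) auto
    also have "\<dots> \<le> T ^ n" using T by simp
    finally show "4 * (real N * (4 ^ s / 4)) * (2 * \<theta>) ^ n \<le> T ^ n" .
    fix x y assume xy: "x \<in> S" "y \<in> S" "y \<in> Nb x" "y \<notin> Cl x"
    have far: "u < sk_norm p ks (\<lambda>i. y i - x i)" using xy by (auto simp: Cl_def S_def superball_def)
    have "Nb x \<inter> Nb y \<subseteq> superball n p ks (\<lambda>i. (x i + y i) / 2) ((2 * \<theta>) * u)"
    proof
      fix z assume z: "z \<in> Nb x \<inter> Nb y"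
      \<comment> \<open>The vectors z - x and z - y have norm at most 2 u, and their difference y -
        x has norm above u; their midpoint is z minus the midpoint of x and y.\<close>
      have "sk_norm p ks (\<lambda>i. ((z i - x i) + (z i - y i)) / 2) \<le> \<theta> * (2 * u)"
        using z far u by (intro uc) (auto simp: Nb_def superball_def)
      moreover have "(\<lambda>i. ((z i - x i) + (z i - y i)) / 2) = (\<lambda>i. z i - (x i + y i) / 2)"
        by (auto simp: add_divide_distrib diff_divide_distrib)
      ultimately show "z \<in> superball n p ks (\<lambda>i. (x i + y i) / 2) ((2 * \<theta>) * u)"
        using z by (simp add: superball_def Nb_def mult_ac)
    qed
    then have "emeasure (lebn n) (Nb x \<inter> Nb y)
        \<le> emeasure (lebn n) (superball n p ks (\<lambda>i. (x i + y i) / 2) ((2 * \<theta>) * u))"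
      by (rule emeasure_mono) (rule superball_sets[OF k])
    then show "emeasure (lebn n) (Nb x \<inter> Nb y) \<le> ennreal ((2 * \<theta>) ^ n)"
      using vol[of "2 * \<theta>"] \<theta> by simp
  qed
  then obtain x where good: "\<forall>k<N. x k \<in> S \<and> real (card {i. i < k \<and> x k \<in> Nb (x i)}) \<le> 4 ^ s / 4 \<and>
    (\<forall>i<k. x k \<notin> Cl (x i)) \<and>
    (\<forall>i j. i < j \<longrightarrow> j < k \<longrightarrow> x j \<in> Nb (x i) \<longrightarrow> x k \<notin> Nb (x i) \<inter> Nb (x j))" ..
  have x: "x k \<in> S" and xb: "real (card {i. i < k \<and> x k \<in> Nb (x i)}) \<le> 4 ^ s / 4"
    and xt: "\<And>i j. i < j \<Longrightarrow> j < k \<Longrightarrow> x j \<in> Nb (x i) \<Longrightarrow> x k \<notin> Nb (x i) \<inter> Nb (x j)"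
    if "k < N" for k
    using good[rule_format, OF that] by simp_all
  define adj where "adj i j \<longleftrightarrow> i \<noteq> j \<and> i < N \<and> j < N \<and> x j \<in> Nb (x i)" for i j
  have Nbsym: "x i \<in> Nb (x j)" if "i < N" "j < N" "x j \<in> Nb (x i)" for i j
    using that x[of i] sk_norm_minus_commute[OF p0, of ks "x i" "x j"]
    by (simp add: Nb_def superball_def S_def)
  have "\<exists>W\<subseteq>{..<N}. (\<forall>x\<in>W. \<forall>y\<in>W. \<not> adj x y) \<and> real s * real N \<le> 16 * 4 ^ s * real (card W)"
  proof (rule back_degree_indep_set)
    show "adj j i" if "adj i j" for i j using that Nbsym[of i j] by (simp add: adj_def)
    show "\<not> adj i i" for i by (simp add: adj_def)
    show "\<not> adj i k" if "k < N" "i < j" "j < k" "adj i j" "adj j k" for i j k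
      using xt[of k i j] that by (simp add: adj_def)
    show "4 * real (card {i. i < k \<and> adj i k}) \<le> 4 ^ s" if "k < N" for k
    proof -
      have "{i. i < k \<and> adj i k} = {i. i < k \<and> x k \<in> Nb (x i)}" using that by (auto simp: adj_def)
      then show ?thesis using xb[OF that] by simp
    qed
  qed
  then obtain W where W: "W \<subseteq> {..<N}" "\<And>i j. i \<in> W \<Longrightarrow> j \<in> W \<Longrightarrow> \<not> adj i j"
    "real s * real N \<le> 16 * 4 ^ s * real (card W)" by blast
  have sep: "2 * u < sk_norm p ks (\<lambda>l. x j l - x i l)" if "i \<in> W" "j \<in> W" "i \<noteq> j" for i j
  proof -
    have "i < N" "j < N" using that W(1) by auto
    then have "x j \<notin> Nb (x i)" using W(2)[of i j] that by (auto simp: adj_def)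
    then show ?thesis using x[OF \<open>j < N\<close>] by (auto simp: Nb_def superball_def S_def)
  qed
  have z: "sk_norm p ks (\<lambda>l. y l - y l) = 0" for y using sk_norm_scale[OF p0, of ks 0] by simp
  \<comment> \<open>Independence concerns indices; separation makes the points distinct, so the
    count carries over to them.\<close>
  have inj: "inj_on x W"
  proof (rule inj_onI, rule ccontr)
    fix i j assume ij: "i \<in> W" "j \<in> W" "x i = x j" "i \<noteq> j"
    then show False using sep[OF ij(1,2,4)] z[of "x j"] u by simp
  qed
  show ?thesis
  proof (intro exI[of _ "x ` W"] conjI)
    show "x ` W \<subseteq> superball n p ks (\<lambda>_. 0) (T * u)" using W(1) x by (auto simp: S_def)
    show "finite (x ` W)" using W(1) finite_subset by blast
    show "\<forall>y\<in>x ` W. \<forall>z\<in>x ` W. y \<noteq> z \<longrightarrow> 2 * u < sk_norm p ks (\<lambda>i. z i - y i)"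
      using sep by auto
    show "real s * real N \<le> 16 * 4 ^ s * real (card (x ` W))" using W(3) by (simp add: card_image[OF inj])
  qed
qed

text \<open>Separation is strict, so even the closed balls are disjoint and their volumes add up.
  Enlarging the container by one unit radius keeps every ball inside, so no volume is lost at the
  boundary.\<close>

lemma separated_packing:
  assumes k: "valid_k n ks" and p: "1 < p" and T: "0 < T"
  defines "u \<equiv> unit_radius n p ks"
  assumes P: "P \<subseteq> superball n p ks (\<lambda>_. 0) (T * u)" and fin: "finite P"
    and sep: "\<And>x y. x \<in> P \<Longrightarrow> y \<in> P \<Longrightarrow> x \<noteq> y \<Longrightarrow> 2 * u < sk_norm p ks (\<lambda>i. y i - x i)"
  shows "is_packing n p ks P"
    and "measure (lebn n) (superball n p ks (\<lambda>_. 0) ((T + 1) * u) \<inter> (\<Union>x\<in>P. superball n p ks x u)) = real (card P)"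
proof -
  have p0: "0 < p" and p1: "1 \<le> p" using p by auto
  have dis: "superball n p ks x u \<inter> superball n p ks y u = {}" if "x \<in> P" "y \<in> P" "x \<noteq> y" for x y
  proof (rule ccontr)
    assume "superball n p ks x u \<inter> superball n p ks y u \<noteq> {}"
    then obtain z where z: "sk_norm p ks (\<lambda>i. z i - x i) \<le> u" "sk_norm p ks (\<lambda>i. z i - y i) \<le> u"
      by (auto simp: superball_def)
    have "sk_norm p ks (\<lambda>i. y i - x i) = sk_norm p ks (\<lambda>i. (y i - z i) + (z i - x i))" by simp
    also have "\<dots> \<le> sk_norm p ks (\<lambda>i. y i - z i) + sk_norm p ks (\<lambda>i. z i - x i)"
      by (rule sk_norm_triangle[OF p1])
    also have "\<dots> \<le> 2 * u" using z sk_norm_minus_commute[OF p0, of ks y z] by simp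
    finally show False using sep[OF that] by simp
  qed
  show "is_packing n p ks P"
    unfolding is_packing_def u_def[symmetric]
  proof (intro conjI ballI impI)
    show "P \<subseteq> Rn n" using P by (auto simp: superball_def)
    fix x y assume "x \<in> P" "y \<in> P" "x \<noteq> y"
    from dis[OF this] show "top_of_set (Rn n) interior_of superball n p ks x u \<inter>
        top_of_set (Rn n) interior_of superball n p ks y u = {}"
      using interior_of_subset[of "top_of_set (Rn n)"] by blast
  qed
  have "superball n p ks x u \<subseteq> superball n p ks (\<lambda>_. 0) ((T + 1) * u)" if "x \<in> P" for x
  proof
    fix z assume z: "z \<in> superball n p ks x u"
    have "sk_norm p ks z = sk_norm p ks (\<lambda>i. (z i - x i) + x i)" by simp
    also have "\<dots> \<le> sk_norm p ks (\<lambda>i. z i - x i) + sk_norm p ks x"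
      by (rule sk_norm_triangle[OF p1])
    also have "\<dots> \<le> u + T * u" using z that P by (intro add_mono) (auto simp: superball_def)
    finally show "z \<in> superball n p ks (\<lambda>_. 0) ((T + 1) * u)"
      using z by (simp add: superball_def algebra_simps)
  qed
  then have eq: "superball n p ks (\<lambda>_. 0) ((T + 1) * u) \<inter> (\<Union>x\<in>P. superball n p ks x u) = (\<Union>x\<in>P. superball n p ks x u)"
    by blast
  have "emeasure (lebn n) (\<Union>x\<in>P. superball n p ks x u) = (\<Sum>x\<in>P. emeasure (lebn n) (superball n p ks x u))"
    using dis fin superball_sets[OF k]
    by (intro sum_emeasure[symmetric]) (auto simp: disjoint_family_on_def)
  also have "\<dots> = (\<Sum>x\<in>P. 1)"
    using emeasure_superball[OF k p0, of 1] by (intro sum.cong refl) (simp add: u_def)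
  also have "\<dots> = ennreal (real (card P))" by (simp add: ennreal_of_nat_eq_real_of_nat)
  finally show "measure (lebn n) (superball n p ks (\<lambda>_. 0) ((T + 1) * u) \<inter> (\<Union>x\<in>P. superball n p ks x u)) = real (card P)"
    unfolding eq by (simp add: measure_def)
qed

text \<open>The empty packing is admissible. This settles the small dimensions, where \<eta> is
  -1.\<close>

lemma packing_density_nonneg: "0 \<le> packing_density p ks n"
proof -
  have "is_packing n p ks {}" by (simp add: is_packing_def)
  then have "0 \<le> (SUP P\<in>{P. is_packing n p ks P}.
        ereal (measure (lebn n) (superball n p ks (\<lambda>_. 0) R \<inter>
                 (\<Union>x\<in>P. superball n p ks x (unit_radius n p ks)))
               / measure (lebn n) (superball n p ks (\<lambda>_. 0) R)))" for R
    by (intro SUP_upper2[of "{}"]) auto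
  then show ?thesis
    unfolding packing_density_def by (intro le_Limsup always_eventually) auto
qed

text \<open>The constant 1024 collects 16 from the number of points, 2 from rounding it down, 16
  from the independent set and 2 from the boundary layer.\<close>

lemma packing_density_lower_bound:
  assumes k: "valid_k n ks" and p: "1 < p" and \<theta>: "0 < \<theta>"
    and uc: "\<And>a b r. 0 < r \<Longrightarrow> sk_norm p ks a \<le> r \<Longrightarrow> sk_norm p ks b \<le> r \<Longrightarrow>
           r / 2 \<le> sk_norm p ks (\<lambda>i. a i - b i) \<Longrightarrow> sk_norm p ks (\<lambda>i. (a i + b i) / 2) \<le> \<theta> * r"
    and s: "(4::real) ^ s \<le> 2 ^ n" "16 ^ s * \<theta> ^ n \<le> 1"
  shows "ereal (real s / (1024 * 2 ^ n)) \<le> packing_density p ks n"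
proof -
  define u where "u = unit_radius n p ks"
  have p0: "0 < p" using p by simp
  have u: "0 < u" unfolding u_def by (rule unit_radius[OF k p0])
  have n: "0 < n" by (rule valid_k_pos[OF k])
  define F where "F R = (SUP P\<in>{P. is_packing n p ks P}.
        ereal (measure (lebn n) (superball n p ks (\<lambda>_. 0) R \<inter> (\<Union>x\<in>P. superball n p ks x u))
               / measure (lebn n) (superball n p ks (\<lambda>_. 0) R)))" for R
  \<comment> \<open>The term \<open>16 * 2 ^ n\<close> makes \<open>v\<close> at least 1, so that
    rounding costs at most a factor 2; the term \<open>2 * real n\<close> lets Bernoulli's
    inequality bound the cost of the boundary layer by a factor 2.\<close>
  have "ereal (real s / (1024 * 2 ^ n)) \<le> F R" if R: "(16 * 2 ^ n + 1 + 2 * real n) * u \<le> R" for R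
  proof -
    define T where "T = R / u - 1"
    have RT: "R = (T + 1) * u" using u by (simp add: T_def)
    have "16 * 2 ^ n + 1 + 2 * real n \<le> R / u" using R u by (simp add: pos_le_divide_eq)
    then have T: "16 * 2 ^ n \<le> T" "2 * real n \<le> T + 1"
      using zero_less_power[of "2::real" n] unfolding T_def by linarith+
    have "1 \<le> (2::real) ^ n" by simp
    then have T1: "1 \<le> T" using T by linarith
    define v where "v = T ^ n * 4 ^ s / (16 * 2 ^ n)"
    have "16 * 2 ^ n * 1 \<le> T ^ n * 4 ^ s"
      using T T1 self_le_power[OF T1 n] by (intro mult_mono) auto
    then have v: "1 \<le> v" by (simp add: v_def)
    define N where "N = nat \<lfloor>v\<rfloor>"
    have "1 \<le> \<lfloor>v\<rfloor>" using v by simp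
    then have "real N = of_int \<lfloor>v\<rfloor>" "1 \<le> real_of_int \<lfloor>v\<rfloor>" by (simp_all add: N_def)
    then have N: "real N \<le> v" "v \<le> 2 * real N"
      using of_int_floor_le[of v] real_of_int_floor_add_one_gt[of v] by linarith+
    have "16 * 2 ^ n * real N \<le> T ^ n * 4 ^ s"
      using N(1) by (simp add: v_def field_simps)
    moreover have "0 < T" using T1 by simp
    ultimately obtain P where P: "P \<subseteq> superball n p ks (\<lambda>_. 0) (T * u)" "finite P"
      "\<And>x y. x \<in> P \<Longrightarrow> y \<in> P \<Longrightarrow> x \<noteq> y \<Longrightarrow> 2 * u < sk_norm p ks (\<lambda>i. y i - x i)"
      "real s * real N \<le> 16 * 4 ^ s * real (card P)"
      using separated_points_exist[OF k p \<theta> uc s, of T N] unfolding u_def by blast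
    note pk = separated_packing[OF k p \<open>0 < T\<close> P(1,2)[unfolded u_def] P(3)[unfolded u_def], folded u_def]
    have mP: "measure (lebn n) (superball n p ks (\<lambda>_. 0) R \<inter> (\<Union>x\<in>P. superball n p ks x u)) = real (card P)"
      unfolding RT by (rule pk(2))
    have mR: "measure (lebn n) (superball n p ks (\<lambda>_. 0) R) = (T + 1) ^ n"
      using emeasure_superball[OF k p0, of "T + 1"] T1 by (simp add: RT u_def measure_def)
    have "real s * v \<le> real s * (2 * real N)" using N by (intro mult_left_mono) auto
    then have "real s * v \<le> 32 * 4 ^ s * real (card P)" using P(4) by simp
    then have "real s * T ^ n / (16 * 2 ^ n) * 4 ^ s \<le> 32 * real (card P) * 4 ^ s"
      by (simp add: v_def mult_ac)
    then have c1: "real s * T ^ n / (16 * 2 ^ n) \<le> 32 * real (card P)"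
      by (rule mult_right_le_imp_le) simp
    have "1 / 2 \<le> 1 + real n * (- (1 / (T + 1)))" using T T1 by (simp add: field_simps)
    also have "\<dots> \<le> (1 + (- (1 / (T + 1)))) ^ n"
      using T1 by (intro Bernoulli_inequality) (simp add: field_simps)
    also have "1 + (- (1 / (T + 1))) = T / (T + 1)" using T1 by (simp add: field_simps)
    finally have "(T + 1) ^ n \<le> 2 * T ^ n" using T1 by (simp add: power_divide field_simps)
    then have "real s / (512 * 2 ^ n) * ((T + 1) ^ n / 2) \<le> real s / (512 * 2 ^ n) * T ^ n"
      by (intro mult_left_mono) auto
    also have "\<dots> \<le> real (card P)" using c1 by simp
    finally have "real s / (1024 * 2 ^ n) * (T + 1) ^ n \<le> real (card P)" by simp
    moreover have "0 < (T + 1) ^ n" using T1 by simp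
    ultimately have "real s / (1024 * 2 ^ n) \<le> real (card P) / (T + 1) ^ n"
      by (simp only: pos_le_divide_eq)
    then have "ereal (real s / (1024 * 2 ^ n)) \<le> ereal (measure (lebn n) (superball n p ks (\<lambda>_. 0) R \<inter>
        (\<Union>x\<in>P. superball n p ks x u)) / measure (lebn n) (superball n p ks (\<lambda>_. 0) R))"
      unfolding mR mP by (simp only: ereal_less_eq)
    then show ?thesis
      unfolding F_def by (rule SUP_upper2[rotated]) (rule CollectI, rule pk(1))
  qed
  then have "\<forall>\<^sub>F R in at_top. ereal (real s / (1024 * 2 ^ n)) \<le> F R"
    unfolding eventually_at_top_linorder by blast
  then have "ereal (real s / (1024 * 2 ^ n)) \<le> Limsup at_top F" by (intro le_Limsup) auto
  moreover have "packing_density p ks n = Limsup at_top F"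
    unfolding packing_density_def F_def u_def ..
  ultimately show ?thesis by simp
qed

section \<open>From the bound in a fixed dimension to the asymptotic statement\<close>

theorem theorem2:
  fixes p :: real
  assumes "1 < p" and "p \<le> 2"
  shows "\<exists>(c::real) (\<eta>::nat \<Rightarrow> real). 0 < c \<and> c < 2 \<and> \<eta> \<longlonglongrightarrow> 0 \<and>
           (\<forall>(n::nat) ks. valid_k n ks \<longrightarrow>
              packing_density p ks n \<ge>
                ereal ((1 + \<eta> n) * (ln (2 / c) * real n / 2 ^ n)))"
proof -
  obtain \<theta> where \<theta>: "0 < \<theta>" "\<theta> < 1"
    and uc: "\<And>ks a b r. 0 < r \<Longrightarrow> sk_norm p ks a \<le> r \<Longrightarrow> sk_norm p ks b \<le> r \<Longrightarrow>
           r / 2 \<le> sk_norm p ks (\<lambda>i. a i - b i) \<Longrightarrow> sk_norm p ks (\<lambda>i. (a i + b i) / 2) \<le> \<theta> * r"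
    using sk_norm_uniformly_convex[OF assms(1)] by blast
  \<comment> \<open>For \<open>s\<close> the floor of \<open>\<gamma> * n\<close>, the first entry
    of the minimum yields \<open>4 ^ s \<le> 2 ^ n\<close> and the second yields
    \<open>16 ^ s * \<theta> ^ n \<le> 1\<close>.\<close>
  define \<gamma> where "\<gamma> = min (1/2) (ln (1 / \<theta>) / ln 16)"
  have \<gamma>: "0 < \<gamma>" "\<gamma> \<le> 1/2" unfolding \<gamma>_def using \<theta> by (simp, intro min.cobounded1)
  have \<gamma>16: "\<gamma> * ln 16 \<le> - ln \<theta>"
  proof -
    have "\<gamma> * ln 16 \<le> ln (1 / \<theta>) / ln 16 * ln 16" by (intro mult_right_mono) (auto simp: \<gamma>_def)
    then show ?thesis using \<theta> by (simp add: ln_div)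
  qed
  \<comment> \<open>2048 is 1024 from the density bound times 2 for the floor: \<open>s\<close> is
    at least half of \<open>\<gamma> * n\<close> once \<open>n\<close> is at least
    \<open>2 / \<gamma>\<close>, the threshold in \<eta>.\<close>
  define \<epsilon> where "\<epsilon> = \<gamma> / 2048"
  define c where "c = 2 * exp (- \<epsilon>)"
  define \<eta> :: "nat \<Rightarrow> real" where "\<eta> n = (if 2 / \<gamma> \<le> real n then 0 else - 1)" for n
  have c: "0 < c" "c < 2" "ln (2 / c) = \<epsilon>" using \<gamma> by (auto simp: c_def \<epsilon>_def ln_div)
  have "\<forall>\<^sub>F n in sequentially. \<eta> n = 0"
    using eventually_ge_at_top[of "nat \<lceil>2 / \<gamma>\<rceil>"]
    by eventually_elim (simp add: \<eta>_def nat_ceiling_le_eq)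
  then have "\<eta> \<longlonglongrightarrow> 0" by (rule tendsto_eventually)
  moreover have "ereal ((1 + \<eta> n) * (ln (2 / c) * real n / 2 ^ n)) \<le> packing_density p ks n"
    if k: "valid_k n ks" for n ks
  proof (cases "2 / \<gamma> \<le> real n")
    case False
    then show ?thesis using packing_density_nonneg[of p ks n] by (simp add: \<eta>_def zero_ereal_def)
  next
    case True
    define s where "s = nat \<lfloor>\<gamma> * real n\<rfloor>"
    have "0 \<le> \<gamma> * real n" using \<gamma> by simp
    then have s: "real s \<le> \<gamma> * real n" "\<gamma> * real n - 1 \<le> real s" by (auto simp: s_def) 
    have "2 \<le> \<gamma> * real n" using True \<gamma> by (simp add: field_simps)
    then have s2: "\<gamma> * real n / 2 \<le> real s" using s by linarith
    have "\<gamma> * real n \<le> 1/2 * real n" using \<gamma> by (intro mult_right_mono) auto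
    then have "real (2 * s) \<le> real n" using s by simp
    then have "2 * s \<le> n" by (simp only: of_nat_le_iff)
    then have "(2::real) ^ (2 * s) \<le> 2 ^ n" by (intro power_increasing) auto
    then have s4: "(4::real) ^ s \<le> 2 ^ n" by (simp add: power_mult)
    have "ln (16 ^ s * \<theta> ^ n) = real s * ln 16 + real n * ln \<theta>"
      using \<theta> by (simp add: ln_mult ln_realpow)
    also have "\<dots> \<le> (\<gamma> * real n) * ln 16 + real n * ln \<theta>"
      using s by (intro add_right_mono mult_right_mono) auto
    also have "\<dots> = real n * (\<gamma> * ln 16 + ln \<theta>)" by (simp add: algebra_simps)
    also have "\<dots> \<le> 0" using \<gamma>16 by (intro mult_nonneg_nonpos) auto
    finally have "16 ^ s * \<theta> ^ n \<le> 1" using \<theta> by (subst (asm) ln_le_zero_iff) auto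
    from packing_density_lower_bound[OF k assms(1) \<theta>(1) uc s4 this]
    have "ereal (real s / (1024 * 2 ^ n)) \<le> packing_density p ks n" .
    moreover have "(1 + \<eta> n) * (ln (2 / c) * real n / 2 ^ n) \<le> real s / (1024 * 2 ^ n)"
      using True s2 by (simp add: \<eta>_def c(3) \<epsilon>_def field_simps)
    ultimately show ?thesis by (meson ereal_less_eq(3) order_trans)
  qed
  ultimately show ?thesis using c by blast
qed

end
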